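(* Let $\mathcal{M}'_m$ be a meridian surface of elliptic type in the Minkowski space $\mathbb{R}^4_1$, parameterized by $z(u,v)=f(u)\,l(v)+g(u)\,e_4$, $u\in I$, $v\in J$, constructed from the meridian curve $m:u\mapsto(f(u),g(u))$ and the curve $c:l=l(v)$ with spherical curvature $\kappa$. Then $\mathcal{M}'_m$ has pointwise 1-type Gauss map of second kind if and only if one of the following cases holds: (i) the curve $c$ has non-zero constant spherical curvature $\kappa$ and the meridian curve $m$ is determined by $f(u)=\pm u+a$, $g(u)=b$, where $a=\mathrm{const}$, $b=\mathrm{const}$. In this case $\mathcal{M}'_m$ is a developable ruled surface lying in a constant hyperplane $\mathbb{E}^3$ of $\mathbb{R}^4_1$. (ii) the curve $c$ has constant spherical curvature $\kappa$ and the meridian curve $m$ is determined by $f(u)=au+a_1$, $g(u)=bu+b_1$, where $a,a_1,b,b_1$ are constants, $a^2\geq1$, $a^2-b^2=1$. In this case $\mathcal{M}'_m$ is either a marginally trapped developable ruled surface (if $\kappa^2=b^2$) or a developable ruled surface lying in a constant hyperplane $\mathbb{E}^3$ (if $\kappa^2-b^2>0$) or $\mathbb{E}^3_1$ (if $\kappa^2-b^2<0$) of $\mathbb{R}^4_1$. (iii) the curve $c$ has zero spherical curvature and the meridian curve $m$ is determined by the solutions $f(u)$ of the differential equation $$\left(\ln\frac{\sqrt{f'^2-1}\left(f(f'^2-1)(ff'')'-f^2f'f''^2-f'(f'^2-1)^2\right)}{(f'^2-1)^2+f^2f''^2-ff'(f'^2-1)(ff'')'}\right)'=\frac{f'f''}{f'^2-1},$$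 with $g(u)$ defined by $g'(u)=\sqrt{f'^2(u)-1}$.
   Context: $\mathbb{R}^4_1$ (also written $\mathbb{E}^4_1$) is the four-dimensional Minkowski space with flat metric $\langle\cdot,\cdot\rangle$ of signature $(3,1)$ and fixed orthonormal frame $e_1,e_2,e_3,e_4$, $\langle e_i,e_i\rangle=1$ for $i=1,2,3$, $\langle e_4,e_4\rangle=-1$. Meridian surface of elliptic type: let $f,g:I\to\mathbb{R}$ be smooth functions on an interval $I\subset\mathbb{R}$ with $f(u)>0$ and $(f'(u))^2-(g'(u))^2=1$ for all $u\in I$ (the plane curve $m:u\mapsto(f(u),g(u))$ is called the meridian curve). Let $c: l=l(v)$, $v\in J$ ($J\subset\mathbb{R}$ an interval), be a smooth curve parameterized by arc-length ($\langle l',l'\rangle=1$) on the unit sphere $S^2(1)$ centered at the origin of the Euclidean space $\mathbb{R}^3=\operatorname{span}\{e_1,e_2,e_3\}$. The surface $\mathcal{M}'_m: z(u,v)=f(u)\,l(v)+g(u)\,e_4$, $u\in I,\ v\in J$, is called a meridian surface of elliptic type; it is spacelike with first fundamental form $du^2+f^2(u)\,dv^2$. Spherical curvature of $c$: put $t=l'$ and let $n(v)$ be the (unique up to sign) vector field such that $\{l,t,n\}$ is an orthonormal frame field of $\mathbb{R}^3$; then $\kappa(v)=\langle t'(v),n(v)\rangle$, and $l'=t$, $t'=\kappa n-l$, $n'=-\kappa t$. Gauss map: with $x=z_u$ and $y=z_v/f$ (an orthonormal tangent frame), the Gauss map is $G=x\wedge y$, regarded as a map from the surface into the vector space $\wedge^2\mathbb{R}^4_1$,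 equipped with the indefinite inner product $\langle a_1\wedge a_2, b_1\wedge b_2\rangle=\det(\langle a_k,b_l\rangle)$. Laplacian: $\Delta G=-\nabla'_x\nabla'_xG+\nabla'_{\nabla_xx}G-\nabla'_y\nabla'_yG+\nabla'_{\nabla_yy}G$, where $\nabla'$ is the flat connection of the ambient space (componentwise differentiation) and $\nabla$ is the Levi-Civita connection of the surface. The surface has pointwise 1-type Gauss map of second kind if $\Delta G=\lambda(G+C)$ for some non-zero smooth function $\lambda$ on the surface and some constant vector $C\neq0$ in $\wedge^2\mathbb{R}^4_1$. A spacelike surface is marginally trapped if its mean curvature vector field $H=\frac12\operatorname{tr}\sigma$ ($\sigma$ the second fundamental form) satisfies $H\neq0$ and $\langle H,H\rangle=0$ at each point. A ruled surface is developable if its tangent plane (equivalently its normal space) is constant along each generator. A hyperplane $\mathbb{E}^3$ (resp. $\mathbb{E}^3_1$) of $\mathbb{R}^4_1$ is an affine hyperplane on which the induced metric is positive definite (resp. Lorentzian, of signature $(2,1)$).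
   Formalization: In (ii), "marginally trapped" is claimed only for b≠0 (κ=b=0 gives a plane, H=0). In (iii), g'=±√(f'²-1), ln is of the absolute value, and the equation (numerator, denominator non-zero) is imposed where f'²≠1, a set required to be dense in I, as it is undefined elsewhere. *)

theory Defs
  imports "HOL-Analysis.Analysis"
begin

text \<open>
  Parameters range over nondegenerate intervals \<open>I\<close>, \<open>J\<close> which need not be open; therefore all
  derivatives are taken relative to the interval (at interior points this is the usual derivative).
\<close>

definition interval_dom :: "real set \<Rightarrow> bool" where
  "interval_dom S \<longleftrightarrow> is_interval S \<and> interior S \<noteq> {}"

definition vderiv :: "real set \<Rightarrow> (real \<Rightarrow> 'a::real_normed_vector) \<Rightarrow> real \<Rightarrow> 'a" where
  "vderiv S h x = vector_derivative h (at x within S)"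

definition smooth_on :: "real set \<Rightarrow> (real \<Rightarrow> 'a::real_normed_vector) \<Rightarrow> bool" where
  "smooth_on S h \<longleftrightarrow>
     (\<exists>F :: nat \<Rightarrow> real \<Rightarrow> 'a. (\<forall>x\<in>S. F 0 x = h x) \<and>
        (\<forall>k. \<forall>x\<in>S. (F k has_vector_derivative F (Suc k) x) (at x within S)))"

text \<open>In two variables, \<open>F i j\<close> is the partial derivative of order \<open>i\<close> in the first and of
  order \<open>j\<close> in the second variable; all of them are required to be jointly continuous.\<close>

definition smooth_on2 ::
  "real set \<Rightarrow> real set \<Rightarrow> (real \<Rightarrow> real \<Rightarrow> 'a::real_normed_vector) \<Rightarrow> bool" where
  "smooth_on2 I J h \<longleftrightarrow>
     (\<exists>F :: nat \<Rightarrow> nat \<Rightarrow> real \<Rightarrow> real \<Rightarrow> 'a.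
        (\<forall>u\<in>I. \<forall>v\<in>J. F 0 0 u v = h u v) \<and>
        (\<forall>i j. continuous_on (I \<times> J) (\<lambda>(u, v). F i j u v)) \<and>
        (\<forall>i j. \<forall>u\<in>I. \<forall>v\<in>J.
           ((\<lambda>s. F i j s v) has_vector_derivative F (Suc i) j u v) (at u within I) \<and>
           ((\<lambda>s. F i j u s) has_vector_derivative F i (Suc j) u v) (at v within J)))"

definition pd1 ::
  "real set \<Rightarrow> (real \<Rightarrow> real \<Rightarrow> 'a::real_normed_vector) \<Rightarrow> real \<Rightarrow> real \<Rightarrow> 'a" where
  "pd1 I F u v = vderiv I (\<lambda>s. F s v) u"

definition pd2 ::
  "real set \<Rightarrow> (real \<Rightarrow> real \<Rightarrow> 'a::real_normed_vector) \<Rightarrow> real \<Rightarrow> real \<Rightarrow> 'a" where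
  "pd2 J F u v = vderiv J (\<lambda>s. F u s) v"


subsection \<open>Minkowski space\<close>

text \<open>The orthonormal frame \<open>e\<^sub>1, \<dots>, e\<^sub>4\<close> is the standard basis \<open>axis i 1\<close> of \<open>real ^ 4\<close>.\<close>

definition mink :: "real ^ 4 \<Rightarrow> real ^ 4 \<Rightarrow> real" where
  "mink a b = a $ 1 * b $ 1 + a $ 2 * b $ 2 + a $ 3 * b $ 3 - a $ 4 * b $ 4"

definition R3 :: "(real ^ 4) set" where
  "R3 = span {axis 1 1, axis 2 1, axis 3 1}"

text \<open>The exterior square \<open>\<And>\<^sup>2\<close> is realised as the space of skew-symmetric matrices, with
  \<open>a \<and> b = a b\<^sup>T - b a\<^sup>T\<close>.\<close>

definition bivectors :: "(real ^ 4 ^ 4) set" where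
  "bivectors = {A. transpose A = - A}"

definition wedge :: "real ^ 4 \<Rightarrow> real ^ 4 \<Rightarrow> real ^ 4 ^ 4" where
  "wedge a b = (\<chi> i j. a $ i * b $ j - a $ j * b $ i)"

definition directions :: "(real ^ 4) set \<Rightarrow> (real ^ 4) set" where
  "directions W = {p - q | p q. p \<in> W \<and> q \<in> W}"

definition hyperplane_E3 :: "(real ^ 4) set \<Rightarrow> bool" where
  "hyperplane_E3 W \<longleftrightarrow> affine W \<and> aff_dim W = 3 \<and>
     (\<forall>d\<in>directions W. d \<noteq> 0 \<longrightarrow> mink d d > 0)"

text \<open>Three orthonormal directions of signs \<open>+, +, -\<close> are linearly independent, hence form a
  basis of the three-dimensional direction space.\<close>

definition hyperplane_E31 :: "(real ^ 4) set \<Rightarrow> bool" where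
  "hyperplane_E31 W \<longleftrightarrow> affine W \<and> aff_dim W = 3 \<and>
     (\<exists>d1\<in>directions W. \<exists>d2\<in>directions W. \<exists>d3\<in>directions W.
        mink d1 d1 = 1 \<and> mink d2 d2 = 1 \<and> mink d3 d3 = -1 \<and>
        mink d1 d2 = 0 \<and> mink d1 d3 = 0 \<and> mink d2 d3 = 0)"

definition surface_in :: "real set \<Rightarrow> real set \<Rightarrow> (real \<Rightarrow> real \<Rightarrow> real ^ 4) \<Rightarrow> (real ^ 4) set \<Rightarrow> bool" where
  "surface_in I J z W \<longleftrightarrow> (\<forall>u\<in>I. \<forall>v\<in>J. z u v \<in> W)"


subsection \<open>Meridian surfaces of elliptic type\<close>

definition meridian_surface ::
  "(real \<Rightarrow> real) \<Rightarrow> (real \<Rightarrow> real) \<Rightarrow> (real \<Rightarrow> real ^ 4) \<Rightarrow> real \<Rightarrow> real \<Rightarrow> real ^ 4" where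
  "meridian_surface f g l u v = f u *\<^sub>R l v + g u *\<^sub>R axis 4 1"

text \<open>The field \<open>n\<close> is unique only up to sign, so it is part of the data; being smooth it cannot
  switch sign along \<open>c\<close>.\<close>

definition elliptic_meridian_data ::
  "real set \<Rightarrow> real set \<Rightarrow> (real \<Rightarrow> real) \<Rightarrow> (real \<Rightarrow> real) \<Rightarrow> (real \<Rightarrow> real ^ 4) \<Rightarrow> (real \<Rightarrow> real ^ 4) \<Rightarrow> bool"
  where
  "elliptic_meridian_data I J f g l n \<longleftrightarrow>
     interval_dom I \<and> interval_dom J \<and>
     smooth_on I f \<and> smooth_on I g \<and>
     (\<forall>u\<in>I. f u > 0 \<and> (vderiv I f u)\<^sup>2 - (vderiv I g u)\<^sup>2 = 1) \<and>
     smooth_on J l \<and> smooth_on J n \<and>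
     (\<forall>v\<in>J. l v \<in> R3 \<and> n v \<in> R3 \<and>
        mink (l v) (l v) = 1 \<and> mink (vderiv J l v) (vderiv J l v) = 1 \<and>
        mink (n v) (n v) = 1 \<and> mink (n v) (l v) = 0 \<and> mink (n v) (vderiv J l v) = 0)"

definition spherical_curvature ::
  "real set \<Rightarrow> (real \<Rightarrow> real ^ 4) \<Rightarrow> (real \<Rightarrow> real ^ 4) \<Rightarrow> real \<Rightarrow> real" where
  "spherical_curvature J l n v = mink (vderiv J (vderiv J l) v) (n v)"


subsection \<open>Geometry of a surface with an orthonormal frame along the parameter lines\<close>

text \<open>In what follows \<open>z\<close> is a surface for which \<open>x = z\<^sub>u\<close>, \<open>y = z\<^sub>v / f\<close> is an orthonormal tangent
  frame; \<open>D_x\<close>, \<open>D_y\<close> are the flat derivatives in these directions.\<close>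

definition D_x :: "real set \<Rightarrow> (real \<Rightarrow> real \<Rightarrow> 'a::real_normed_vector) \<Rightarrow> real \<Rightarrow> real \<Rightarrow> 'a" where
  "D_x I F u v = pd1 I F u v"

definition D_y ::
  "real set \<Rightarrow> (real \<Rightarrow> real) \<Rightarrow> (real \<Rightarrow> real \<Rightarrow> 'a::real_normed_vector) \<Rightarrow> real \<Rightarrow> real \<Rightarrow> 'a" where
  "D_y J f F u v = (1 / f u) *\<^sub>R pd2 J F u v"

definition frame_x :: "real set \<Rightarrow> (real \<Rightarrow> real \<Rightarrow> real ^ 4) \<Rightarrow> real \<Rightarrow> real \<Rightarrow> real ^ 4" where
  "frame_x I z u v = pd1 I z u v"

definition frame_y ::
  "real set \<Rightarrow> (real \<Rightarrow> real) \<Rightarrow> (real \<Rightarrow> real \<Rightarrow> real ^ 4) \<Rightarrow> real \<Rightarrow> real \<Rightarrow> real ^ 4" where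
  "frame_y J f z u v = (1 / f u) *\<^sub>R pd2 J z u v"

definition tangential ::
  "real set \<Rightarrow> real set \<Rightarrow> (real \<Rightarrow> real) \<Rightarrow> (real \<Rightarrow> real \<Rightarrow> real ^ 4) \<Rightarrow>
   (real \<Rightarrow> real \<Rightarrow> real ^ 4) \<Rightarrow> real \<Rightarrow> real \<Rightarrow> real ^ 4" where
  "tangential I J f z X u v =
     mink (X u v) (frame_x I z u v) *\<^sub>R frame_x I z u v +
     mink (X u v) (frame_y J f z u v) *\<^sub>R frame_y J f z u v"

text \<open>The flat derivative \<open>\<nabla>'\<^sub>X F\<close> along a tangent field \<open>X\<close>.\<close>

definition D_tan ::
  "real set \<Rightarrow> real set \<Rightarrow> (real \<Rightarrow> real) \<Rightarrow> (real \<Rightarrow> real \<Rightarrow> real ^ 4) \<Rightarrow>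
   (real \<Rightarrow> real \<Rightarrow> real ^ 4) \<Rightarrow> (real \<Rightarrow> real \<Rightarrow> 'a::real_normed_vector) \<Rightarrow> real \<Rightarrow> real \<Rightarrow> 'a" where
  "D_tan I J f z X F u v =
     mink (X u v) (frame_x I z u v) *\<^sub>R D_x I F u v +
     mink (X u v) (frame_y J f z u v) *\<^sub>R D_y J f F u v"

text \<open>By the Gauss formula, the Levi-Civita connection is the tangential part of the flat one:
  \<open>nabla_xx\<close> and \<open>nabla_yy\<close> are \<open>\<nabla>\<^sub>x x\<close> and \<open>\<nabla>\<^sub>y y\<close>.\<close>

definition nabla_xx where
  "nabla_xx I J f z = tangential I J f z (D_x I (frame_x I z))"

definition nabla_yy where
  "nabla_yy I J f z = tangential I J f z (D_y J f (frame_y J f z))"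

definition laplacian ::
  "real set \<Rightarrow> real set \<Rightarrow> (real \<Rightarrow> real) \<Rightarrow> (real \<Rightarrow> real \<Rightarrow> real ^ 4) \<Rightarrow>
   (real \<Rightarrow> real \<Rightarrow> 'a::real_normed_vector) \<Rightarrow> real \<Rightarrow> real \<Rightarrow> 'a" where
  "laplacian I J f z F u v =
     - D_x I (D_x I F) u v + D_tan I J f z (nabla_xx I J f z) F u v
     - D_y J f (D_y J f F) u v + D_tan I J f z (nabla_yy I J f z) F u v"

definition gauss_map ::
  "real set \<Rightarrow> real set \<Rightarrow> (real \<Rightarrow> real) \<Rightarrow> (real \<Rightarrow> real \<Rightarrow> real ^ 4) \<Rightarrow> real \<Rightarrow> real \<Rightarrow> real ^ 4 ^ 4" where
  "gauss_map I J f z u v = wedge (frame_x I z u v) (frame_y J f z u v)"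

definition pointwise_1_type_second_kind ::
  "real set \<Rightarrow> real set \<Rightarrow> (real \<Rightarrow> real) \<Rightarrow> (real \<Rightarrow> real \<Rightarrow> real ^ 4) \<Rightarrow> bool" where
  "pointwise_1_type_second_kind I J f z \<longleftrightarrow>
     (\<exists>lam C. smooth_on2 I J lam \<and> (\<forall>u\<in>I. \<forall>v\<in>J. lam u v \<noteq> 0) \<and>
        C \<in> bivectors \<and> C \<noteq> 0 \<and>
        (\<forall>u\<in>I. \<forall>v\<in>J.
           laplacian I J f z (gauss_map I J f z) u v = lam u v *\<^sub>R (gauss_map I J f z u v + C)))"

text \<open>\<open>sigma_xx\<close>, \<open>sigma_yy\<close> are the values of the second fundamental form on the frame, i.e. the
  normal parts of \<open>\<nabla>'\<^sub>x x\<close> and \<open>\<nabla>'\<^sub>y y\<close>.\<close>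

definition sigma_xx where
  "sigma_xx I J f z u v = D_x I (frame_x I z) u v - nabla_xx I J f z u v"

definition sigma_yy where
  "sigma_yy I J f z u v = D_y J f (frame_y J f z) u v - nabla_yy I J f z u v"

definition mean_curvature ::
  "real set \<Rightarrow> real set \<Rightarrow> (real \<Rightarrow> real) \<Rightarrow> (real \<Rightarrow> real \<Rightarrow> real ^ 4) \<Rightarrow> real \<Rightarrow> real \<Rightarrow> real ^ 4" where
  "mean_curvature I J f z u v = (1 / 2) *\<^sub>R (sigma_xx I J f z u v + sigma_yy I J f z u v)"

text \<open>The condition \<open>H \<noteq> 0\<close> excludes planes, which do occur among the meridian surfaces: a great
  circle \<open>c\<close> and constant \<open>g\<close> give \<open>H = 0\<close>.\<close>

definition marginally_trapped ::
  "real set \<Rightarrow> real set \<Rightarrow> (real \<Rightarrow> real) \<Rightarrow> (real \<Rightarrow> real \<Rightarrow> real ^ 4) \<Rightarrow> bool" where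
  "marginally_trapped I J f z \<longleftrightarrow>
     (\<forall>u\<in>I. \<forall>v\<in>J. mean_curvature I J f z u v \<noteq> 0 \<and>
        mink (mean_curvature I J f z u v) (mean_curvature I J f z u v) = 0)"

definition tangent_plane ::
  "real set \<Rightarrow> real set \<Rightarrow> (real \<Rightarrow> real \<Rightarrow> real ^ 4) \<Rightarrow> real \<Rightarrow> real \<Rightarrow> (real ^ 4) set" where
  "tangent_plane I J z u v = span {pd1 I z u v, pd2 J z u v}"

text \<open>The generators are the parameter lines \<open>v = const\<close>.\<close>

definition developable_ruled ::
  "real set \<Rightarrow> real set \<Rightarrow> (real \<Rightarrow> real \<Rightarrow> real ^ 4) \<Rightarrow> bool" where
  "developable_ruled I J z \<longleftrightarrow>
     (\<forall>v\<in>J. \<exists>p w. w \<noteq> 0 \<and> (\<forall>u\<in>I. \<exists>s. z u v = p + s *\<^sub>R w)) \<and>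
     (\<forall>v\<in>J. \<forall>u1\<in>I. \<forall>u2\<in>I. tangent_plane I J z u1 v = tangent_plane I J z u2 v)"


subsection \<open>The differential equation for the meridian curve\<close>

definition ode_num :: "real set \<Rightarrow> (real \<Rightarrow> real) \<Rightarrow> real \<Rightarrow> real" where
  "ode_num I f u =
     (let f0 = f u; f1 = vderiv I f u; f2 = vderiv I (vderiv I f) u;
          h = vderiv I (\<lambda>s. f s * vderiv I (vderiv I f) s) u
      in f0 * (f1\<^sup>2 - 1) * h - f0\<^sup>2 * f1 * f2\<^sup>2 - f1 * (f1\<^sup>2 - 1)\<^sup>2)"

definition ode_den :: "real set \<Rightarrow> (real \<Rightarrow> real) \<Rightarrow> real \<Rightarrow> real" where
  "ode_den I f u =
     (let f0 = f u; f1 = vderiv I f u; f2 = vderiv I (vderiv I f) u;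
          h = vderiv I (\<lambda>s. f s * vderiv I (vderiv I f) s) u
      in (f1\<^sup>2 - 1)\<^sup>2 + f0\<^sup>2 * f2\<^sup>2 - f0 * f1 * (f1\<^sup>2 - 1) * h)"

text \<open>The equation is an identity between logarithmic derivatives, so the logarithm is that of the
  absolute value; numerator and denominator must not vanish for it to be defined.
  It is meaningless where \<open>f'\<^sup>2 = 1\<close> and is imposed at all remaining points, which have to be dense.\<close>

definition meridian_ode :: "real set \<Rightarrow> (real \<Rightarrow> real) \<Rightarrow> bool" where
  "meridian_ode I f \<longleftrightarrow>
     I \<subseteq> closure {u\<in>I. (vderiv I f u)\<^sup>2 \<noteq> 1} \<and>
     (\<forall>u\<in>I. (vderiv I f u)\<^sup>2 \<noteq> 1 \<longrightarrow>
        ode_num I f u \<noteq> 0 \<and> ode_den I f u \<noteq> 0 \<and>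
        ((\<lambda>s. ln \<bar>sqrt ((vderiv I f s)\<^sup>2 - 1) * ode_num I f s / ode_den I f s\<bar>)
           has_real_derivative
           (vderiv I f u * vderiv I (vderiv I f) u / ((vderiv I f u)\<^sup>2 - 1))) (at u within I))"

end

theory Submission
  imports Defs
begin

text \<open>
  In the basis \<open>l \<and> t, e\<^sub>4 \<and> t, t \<and> n, l \<and> n, e\<^sub>4 \<and> n, e\<^sub>4 \<and> l\<close> the Gauss map is
  \<open>G = f' l \<and> t + g' e\<^sub>4 \<and> t\<close>, and by the Frenet equations a constant bivector \<open>C\<close> has coefficients
  depending on \<open>v\<close> alone and solving a linear system driven by \<open>\<kappa>\<close>. Comparing coefficients in
  \<open>\<Delta> G = \<lambda> (G + C)\<close> makes \<open>\<kappa>\<close> constant. If \<open>\<kappa> \<noteq> 0\<close>, the equations force \<open>f'\<close> to be constant. If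
  \<open>\<kappa> = 0\<close>, then \<open>C = p l \<and> t\<close> and what remains is \<open>A = \<lambda> (f' + p)\<close>, \<open>B = \<lambda> g'\<close> for the coefficients
  \<open>A\<close>, \<open>B\<close> of \<open>\<Delta> G\<close>. Where \<open>g' \<noteq> 0\<close> this says that \<open>p = (A g' - B f') / B\<close> is constant, which is the
  integrated form of the differential equation.

  The delicate point is the converse at zeros of \<open>g'\<close>, where the differential equation is not imposed.
  At a simple zero \<open>p\<close> is determined by \<open>B'\<close>, so it agrees on both sides; a double zero would force
  \<open>g'\<close> to vanish on an interval by uniqueness for linear differential equations. Hence \<open>p\<close> is
  constant on all of \<open>I\<close> and \<open>\<lambda>\<close> extends smoothly and without zeros.
\<close>

subsection \<open>Smooth functions on an interval\<close>

text \<open>Why the differential equation integrates: by unit speed its square root is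
  \<open>\<bar>g'\<bar>\<close> and its right-hand side is the logarithmic derivative of
  \<open>g'\<close>, while numerator over denominator is \<open>p\<close>. What is left is
  \<open>(ln \<bar>p\<bar>)' = 0\<close>, and the non-vanishing numerator matches
  \<open>C \<noteq> 0\<close>. A zero of \<open>g'\<close> may carry no information on
  \<open>p\<close>, so \<open>p\<close> belongs to germs rather than to points and could a priori
  jump across the zeros. At a double zero the equation for \<open>g'\<close> degenerates if
  \<open>f' + p = 0\<close>; it becomes regular again in terms of the hyperbolic angle \<theta> with
  \<open>f' = \<plusminus> cosh \<theta>\<close>, \<open>g' = sinh \<theta>\<close>. The same angle
  governs the curved case, where \<open>f \<theta>'\<close> turns out to be constant. The constant
  bivectors of the converse have one source: if the curvature of \<open>c\<close> is constant, then
  \<open>c\<close> is part of a circle, \<open>t \<and> t'\<close> does not change along it, and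
  \<open>C\<close> is a multiple of it.\<close>

lemma interval_dom_convex: "interval_dom S \<Longrightarrow> convex S"
  by (simp add: interval_dom_def is_interval_convex)

text \<open>Endpoints that belong to the interval are accumulation points too, so one-sided
  derivatives are unique there. This makes \<open>vderiv\<close> computable at every point.\<close>

lemma interval_dom_nontrivial:
  assumes "interval_dom S" "x \<in> S" shows "at x within S \<noteq> bot"
proof -
  obtain y where y: "y \<in> interior S" using assms by (auto simp: interval_dom_def)
  then obtain e where e: "e > 0" "ball y e \<subseteq> S" by (auto simp: mem_interior)
  have "y + e / 2 \<in> S" "y \<in> S" using e by (auto simp: subset_iff dist_real_def)
  moreover have "y + e / 2 \<noteq> y" using e by simp
  moreover have "connected S" using interval_dom_convex[OF assms(1)] convex_connected by blast
  ultimately have "x islimpt S"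
    by (metis assms(2) connected_imp_perfect singletonD)
  then show ?thesis by (simp add: trivial_limit_within)
qed

lemma vderiv_eqI:
  assumes "interval_dom S" "x \<in> S" "\<And>s. s \<in> S \<Longrightarrow> h s = H s"
    and "(H has_vector_derivative D) (at x within S)"
  shows "vderiv S h x = D"
proof -
  have "(h has_vector_derivative D) (at x within S)"
    using assms by (metis has_vector_derivative_transform)
  then show ?thesis
    unfolding vderiv_def using assms interval_dom_nontrivial
    by (metis vector_derivative_within)
qed

lemma smooth_on_has_vderiv:
  assumes "interval_dom S" "smooth_on S h" "x \<in> S"
  shows "(h has_vector_derivative vderiv S h x) (at x within S)"
proof -
  obtain F where F: "\<forall>x\<in>S. F 0 x = h x"
    "\<forall>k. \<forall>x\<in>S. (F k has_vector_derivative F (Suc k) x) (at x within S)"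
    using assms(2) unfolding smooth_on_def by blast
  then have "(h has_vector_derivative F 1 x) (at x within S)"
    using assms by (metis One_nat_def has_vector_derivative_transform)
  then show ?thesis using vderiv_eqI assms by metis
qed

lemma smooth_on_vderiv:
  assumes "interval_dom S" "smooth_on S h"
  shows "smooth_on S (vderiv S h)"
proof -
  obtain F where F: "\<forall>x\<in>S. F 0 x = h x"
    "\<forall>k. \<forall>x\<in>S. (F k has_vector_derivative F (Suc k) x) (at x within S)"
    using assms(2) unfolding smooth_on_def by blast
  have "F (Suc 0) x = vderiv S h x" if "x \<in> S" for x
    using vderiv_eqI[OF assms(1) that, of h "F 0"] F that by (simp; metis)
  then show ?thesis unfolding smooth_on_def
    using F(2) by (intro exI[of _ "\<lambda>k. F (Suc k)"]) auto
qed

lemma smooth_on_continuous: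
  assumes "interval_dom S" "smooth_on S h" shows "continuous_on S h"
  unfolding continuous_on_eq_continuous_within
  by (blast intro: has_vector_derivative_continuous smooth_on_has_vderiv[OF assms])

text \<open>A class closed under one differentiation contains smooth functions only: iterating a
  chosen derivative operator \<open>D\<close> produces the tower that \<open>smooth_on\<close> asks
  for.\<close>

lemma smooth_on_coinduct:
  assumes "P h"
    and step: "\<And>h. P h \<Longrightarrow> \<exists>h'. P h' \<and> (\<forall>x\<in>S. (h has_vector_derivative h' x) (at x within S))"
  shows "smooth_on S h"
proof -
  obtain D where D: "\<And>h. P h \<Longrightarrow> P (D h) \<and> (\<forall>x\<in>S. (h has_vector_derivative D h x) (at x within S))"
    using step by metis
  have "P ((D ^^ k) h)" for k
    by (induction k) (use assms(1) D in auto)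
  then show ?thesis unfolding smooth_on_def
    using D by (intro exI[of _ "\<lambda>k. (D ^^ k) h"]) auto
qed

text \<open>The class fed to the coinduction. The sum, product and reciprocal rules keep derivatives
  inside it, so smoothness is settled one derivative at a time.\<close>

inductive smooth_expr :: "real set \<Rightarrow> (real \<Rightarrow> real) \<Rightarrow> bool" for S where
  base: "smooth_on S h \<Longrightarrow> smooth_expr S h"
| add: "smooth_expr S h \<Longrightarrow> smooth_expr S k \<Longrightarrow> smooth_expr S (\<lambda>x. h x + k x)"
| mult: "smooth_expr S h \<Longrightarrow> smooth_expr S k \<Longrightarrow> smooth_expr S (\<lambda>x. h x * k x)"
| inv: "smooth_expr S h \<Longrightarrow> (\<forall>x\<in>S. h x \<noteq> 0) \<Longrightarrow> smooth_expr S (\<lambda>x. inverse (h x))"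

lemma smooth_on_const: "smooth_on S (\<lambda>x. c)"
  unfolding smooth_on_def
  by (intro exI[of _ "\<lambda>k x. if k = 0 then c else 0"]) auto

lemma smooth_expr_smooth:
  assumes "interval_dom S" "smooth_expr S h" shows "smooth_on S h"
  using assms(2)
proof (rule smooth_on_coinduct[where P = "smooth_expr S"])
  fix h assume "smooth_expr S h"
  then show "\<exists>h'. smooth_expr S h' \<and> (\<forall>x\<in>S. (h has_vector_derivative h' x) (at x within S))"
  proof induction
    case (base h)
    then show ?case
      using smooth_on_vderiv smooth_on_has_vderiv assms(1) smooth_expr.base by metis
  next
    case (add h k)
    then obtain h' k' where *: "smooth_expr S h'" "smooth_expr S k'"
      "\<forall>x\<in>S. (h has_vector_derivative h' x) (at x within S)"
      "\<forall>x\<in>S. (k has_vector_derivative k' x) (at x within S)" by blast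
    show ?case using *
      by (intro exI[of _ "\<lambda>x. h' x + k' x"]) (auto intro: smooth_expr.add has_vector_derivative_add)
  next
    case (mult h k)
    then obtain h' k' where *: "smooth_expr S h'" "smooth_expr S k'"
      "\<forall>x\<in>S. (h has_vector_derivative h' x) (at x within S)"
      "\<forall>x\<in>S. (k has_vector_derivative k' x) (at x within S)" by blast
    show ?case using * mult
      by (intro exI[of _ "\<lambda>x. h x * k' x + h' x * k x"])
        (auto intro: smooth_expr.intros has_vector_derivative_mult)
  next
    case (inv h)
    then obtain h' where *: "smooth_expr S h'"
      "\<forall>x\<in>S. (h has_vector_derivative h' x) (at x within S)" by blast
    have i: "smooth_expr S (\<lambda>x. inverse (h x))"
      using inv.hyps by (rule smooth_expr.inv)
    have "smooth_expr S (\<lambda>x. (- 1) * (inverse (h x) * h' x * inverse (h x)))"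
      by (rule smooth_expr.mult[OF smooth_expr.base[OF smooth_on_const]
            smooth_expr.mult[OF smooth_expr.mult[OF i *(1)] i]])
    moreover have "((\<lambda>x. inverse (h x)) has_vector_derivative
        (- 1) * (inverse (h x) * h' x * inverse (h x))) (at x within S)" if "x \<in> S" for x
    proof -
      have "(h has_real_derivative h' x) (at x within S)"
        using *(2) that by (simp add: has_real_derivative_iff_has_vector_derivative)
      from DERIV_inverse'[OF this] inv.hyps(2) that show ?thesis
        by (simp add: has_real_derivative_iff_has_vector_derivative)
    qed
    ultimately show ?case by blast
  qed
qed

lemma smooth_on_add:
  fixes h k :: "real \<Rightarrow> real"
  assumes "interval_dom S" "smooth_on S h" "smooth_on S k"
  shows "smooth_on S (\<lambda>x. h x + k x)"
  by (rule smooth_expr_smooth[OF assms(1) smooth_expr.add[OF assms(2,3)[THEN smooth_expr.base]]])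

lemma smooth_on_mult:
  fixes h k :: "real \<Rightarrow> real"
  assumes "interval_dom S" "smooth_on S h" "smooth_on S k"
  shows "smooth_on S (\<lambda>x. h x * k x)"
  by (rule smooth_expr_smooth[OF assms(1) smooth_expr.mult[OF assms(2,3)[THEN smooth_expr.base]]])

lemma smooth_on_minus:
  fixes h :: "real \<Rightarrow> real"
  assumes "interval_dom S" "smooth_on S h"
  shows "smooth_on S (\<lambda>x. - h x)"
  using smooth_on_mult[OF assms(1) smooth_on_const[of S "- 1"] assms(2)] by simp

lemma smooth_on_diff:
  fixes h k :: "real \<Rightarrow> real"
  assumes "interval_dom S" "smooth_on S h" "smooth_on S k"
  shows "smooth_on S (\<lambda>x. h x - k x)"
  using smooth_on_add[OF assms(1,2) smooth_on_minus[OF assms(1,3)]] by simp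

lemma smooth_on_divide:
  fixes h k :: "real \<Rightarrow> real"
  assumes "interval_dom S" "smooth_on S h" "smooth_on S k" "\<And>x. x \<in> S \<Longrightarrow> k x \<noteq> 0"
  shows "smooth_on S (\<lambda>x. h x / k x)"
  unfolding divide_inverse
  by (rule smooth_expr_smooth[OF assms(1) smooth_expr.mult[OF smooth_expr.base[OF assms(2)]
          smooth_expr.inv[OF smooth_expr.base[OF assms(3)]]]]) (simp add: assms(4))

lemma smooth_on_power:
  fixes h :: "real \<Rightarrow> real"
  assumes "interval_dom S" "smooth_on S h"
  shows "smooth_on S (\<lambda>x. h x ^ k)"
proof (induction k)
  case 0
  show ?case by (simp add: smooth_on_const)
next
  case (Suc k)
  show ?case using smooth_on_mult[OF assms Suc] by simp
qed

lemma smooth_on2_fst: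
  assumes "interval_dom I" "smooth_on I h"
  shows "smooth_on2 I J (\<lambda>u v. h u)"
proof -
  obtain F where F: "\<forall>x\<in>I. F 0 x = h x"
    "\<forall>k. \<forall>x\<in>I. (F k has_vector_derivative F (Suc k) x) (at x within I)"
    using assms(2) unfolding smooth_on_def by blast
  have c: "continuous_on I (F k)" for k
    unfolding continuous_on_eq_continuous_within
    using F(2) by (blast intro: has_vector_derivative_continuous)
  have "continuous_on (I \<times> J) (\<lambda>x. F k (fst x))" for k
    by (rule continuous_on_compose2[OF c]) (auto intro: continuous_intros)
  then have "continuous_on (I \<times> J) (\<lambda>x. if j = 0 then F i (fst x) else 0)" for i j :: nat
    by (cases "j = 0") auto
  then show ?thesis unfolding smooth_on2_def
    using F by (intro exI[of _ "\<lambda>i j u v. if j = 0 then F i u else 0"])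
      (auto simp: split_def)
qed

lemma smooth_on2_continuous_fst:
  assumes "smooth_on2 I J h" "v \<in> J"
  shows "continuous_on I (\<lambda>u. h u v)"
proof -
  obtain F where F0: "(\<forall>u\<in>I. \<forall>v\<in>J. F 0 0 u v = h u v) \<and>
      (\<forall>i j. continuous_on (I \<times> J) (\<lambda>(u, v). F i j u v)) \<and>
      (\<forall>i j. \<forall>u\<in>I. \<forall>v\<in>J.
           ((\<lambda>s. F i j s v) has_vector_derivative F (Suc i) j u v) (at u within I) \<and>
           ((\<lambda>s. F i j u s) has_vector_derivative F i (Suc j) u v) (at v within J))"
    using assms(1) unfolding smooth_on2_def by (rule exE)
  note F = F0[THEN conjunct1] F0[THEN conjunct2, THEN conjunct1]
  have "continuous_on I (\<lambda>u. (\<lambda>(u, v). F 0 0 u v) (u, v))"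
    using assms(2) by (intro continuous_on_compose2[OF F(2)[rule_format, of 0 0]]) (auto intro: continuous_intros)
  then show ?thesis
    using F(1) assms(2) by (simp cong: continuous_on_cong)
qed

section \<open>Uniqueness for linear systems of two first-order equations\<close>

lemma ode_pair_zero:
  fixes X Y :: "real \<Rightarrow> real"
  assumes cont: "continuous_on {a..b} X" "continuous_on {a..b} Y"
    and der: "\<And>u. a < u \<Longrightarrow> u < b \<Longrightarrow> (X has_real_derivative X' u) (at u)"
      "\<And>u. a < u \<Longrightarrow> u < b \<Longrightarrow> (Y has_real_derivative Y' u) (at u)"
    and bd: "\<And>u. a < u \<Longrightarrow> u < b \<Longrightarrow> \<bar>X' u\<bar> \<le> K * (\<bar>X u\<bar> + \<bar>Y u\<bar>)"
      "\<And>u. a < u \<Longrightarrow> u < b \<Longrightarrow> \<bar>Y' u\<bar> \<le> K * (\<bar>X u\<bar> + \<bar>Y u\<bar>)"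
    and c: "c \<in> {a..b}" "X c = 0" "Y c = 0" and u: "u \<in> {a..b}"
  shows "X u = 0 \<and> Y u = 0"
proof -
  \<comment> \<open>Gronwall for the energy \<open>E\<close>: the bound
    \<open>\<bar>E'\<bar> \<le> 4 K E\<close> makes \<open>E\<close> times
    \<open>exp (- 4 K u)\<close> decreasing and \<open>E\<close> times \<open>exp (4 K u)\<close>
    increasing, which spreads the zero at \<open>c\<close> to the right and to the left.\<close>
  define E where "E u = (X u)\<^sup>2 + (Y u)\<^sup>2" for u
  define E' where "E' u = 2 * X u * X' u + 2 * Y u * Y' u" for u
  have dE: "(E has_real_derivative E' u) (at u)" if "a < u" "u < b" for u
    unfolding E_def E'_def using that
    by (auto intro!: derivative_eq_intros der simp: algebra_simps)
  have bE: "\<bar>E' u\<bar> \<le> 4 * K * E u" if "a < u" "u < b" for u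
  proof -
    define s where "s = \<bar>X u\<bar> + \<bar>Y u\<bar>"
    have "\<bar>E' u\<bar> \<le> 2 * (\<bar>X u\<bar> * \<bar>X' u\<bar> + \<bar>Y u\<bar> * \<bar>Y' u\<bar>)"
      using abs_triangle_ineq[of "X u * X' u" "Y u * Y' u"]
      by (simp add: E'_def abs_mult[symmetric])
    also have "\<dots> \<le> 2 * (\<bar>X u\<bar> * (K * s) + \<bar>Y u\<bar> * (K * s))"
      using bd[OF that] unfolding s_def by (intro mult_left_mono add_mono) auto
    also have "\<dots> = 2 * K * s\<^sup>2" by (simp add: s_def power2_eq_square algebra_simps)
    finally have 1: "\<bar>E' u\<bar> \<le> 2 * K * s\<^sup>2" .
    have "s\<^sup>2 \<le> 2 * E u"
      using sum_squares_ge_zero[of "\<bar>X u\<bar> - \<bar>Y u\<bar>" 0]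
      by (simp add: s_def E_def power2_eq_square algebra_simps)
    \<comment> \<open>\<open>K\<close> comes without a sign; the bound itself excludes
      \<open>K < 0\<close> unless both functions vanish at this point.\<close>
    moreover have "K \<ge> 0 \<or> s = 0"
    proof -
      have "0 \<le> K * s" using order_trans[OF abs_ge_zero bd(1)[OF that]] by (simp add: s_def)
      moreover have "s \<ge> 0" by (simp add: s_def)
      ultimately show ?thesis by (auto simp: zero_le_mult_iff)
    qed
    moreover have "E u = 0" if "s = 0" using that by (auto simp: s_def E_def)
    ultimately have "2 * K * s\<^sup>2 \<le> 4 * K * E u"
      using mult_left_mono[of "s\<^sup>2" "2 * E u" "2 * K"] by (cases "s = 0") auto
    then show ?thesis using 1 by linarith
  qed
  have cE: "continuous_on {a..b} E" unfolding E_def by (intro continuous_intros cont)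
  have "E u \<le> 0"
  proof (cases "c \<le> u")
    case True
    let ?h = "\<lambda>x. - (E x * exp (- 4 * K * x))"
    have "?h c \<le> ?h u"
    proof (rule DERIV_nonneg_imp_increasing_open[OF True])
      fix x assume x: "c < x" "x < u"
      then have x': "a < x" "x < b" using c u by auto
      have "(?h has_real_derivative - (E' x * exp (- 4 * K * x) + E x * (exp (- 4 * K * x) * (- 4 * K)))) (at x)"
        by (auto intro!: derivative_eq_intros dE x')
      moreover have "- (E' x * exp (- 4 * K * x) + E x * (exp (- 4 * K * x) * (- 4 * K))) = (4 * K * E x - E' x) * exp (- 4 * K * x)"
        by (simp add: algebra_simps)
      moreover have "\<dots> \<ge> 0" using bE[OF x'] by (intro mult_nonneg_nonneg) auto
      ultimately show "\<exists>y. (?h has_real_derivative y) (at x) \<and> 0 \<le> y" by metis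
    next
      have "{c..u} \<subseteq> {a..b}" using c u by auto
      then show "continuous_on {c..u} ?h"
        by (intro continuous_intros continuous_on_subset[OF cE])
    qed
    then show ?thesis using c by (simp add: E_def mult_le_0_iff)
  next
    case False
    then have le: "u \<le> c" by simp
    let ?h = "\<lambda>x. E x * exp (4 * K * x)"
    have "?h u \<le> ?h c"
    proof (rule DERIV_nonneg_imp_increasing_open[OF le])
      fix x assume x: "u < x" "x < c"
      then have x': "a < x" "x < b" using c u by auto
      have "(?h has_real_derivative (E' x * exp (4 * K * x) + E x * (exp (4 * K * x) * (4 * K)))) (at x)"
        by (auto intro!: derivative_eq_intros dE x')
      moreover have "(E' x * exp (4 * K * x) + E x * (exp (4 * K * x) * (4 * K))) = (4 * K * E x + E' x) * exp (4 * K * x)"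
        by (simp add: algebra_simps)
      moreover have "\<dots> \<ge> 0" using bE[OF x'] by (intro mult_nonneg_nonneg) auto
      ultimately show "\<exists>y. (?h has_real_derivative y) (at x) \<and> 0 \<le> y" by metis
    next
      have "{u..c} \<subseteq> {a..b}" using c u by auto
      then show "continuous_on {u..c} ?h"
        by (intro continuous_intros continuous_on_subset[OF cE])
    qed
    then show ?thesis using c by (simp add: E_def mult_le_0_iff)
  qed
  then show ?thesis unfolding E_def
    by (simp add: sum_power2_le_zero_iff)
qed

text \<open>Continuous coefficients are bounded on the compact interval, and the bound serves as
  \<open>K\<close>. Derivatives are asked for in the open interval only, so \<open>{a..b}\<close>
  may reach the ends of the parameter interval.\<close>

lemma linear_ode_pair_zero:
  fixes X Y :: "real \<Rightarrow> real"
  assumes cont: "continuous_on {a..b} X" "continuous_on {a..b} Y"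
    and coeff: "continuous_on {a..b} p" "continuous_on {a..b} q" "continuous_on {a..b} r" "continuous_on {a..b} s"
    and der: "\<And>u. a < u \<Longrightarrow> u < b \<Longrightarrow> (X has_real_derivative p u * X u + q u * Y u) (at u)"
      "\<And>u. a < u \<Longrightarrow> u < b \<Longrightarrow> (Y has_real_derivative r u * X u + s u * Y u) (at u)"
    and c: "c \<in> {a..b}" "X c = 0" "Y c = 0" and u: "u \<in> {a..b}"
  shows "X u = 0 \<and> Y u = 0"
proof -
  define M where "M u = \<bar>p u\<bar> + \<bar>q u\<bar> + \<bar>r u\<bar> + \<bar>s u\<bar>" for u
  have "continuous_on {a..b} M" unfolding M_def by (intro continuous_intros coeff)
  then have "compact (M ` {a..b})" by (intro compact_continuous_image) auto
  then have "bdd_above (M ` {a..b})" by (simp add: bounded_imp_bdd_above compact_imp_bounded)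
  then obtain K where K: "\<And>u. u \<in> {a..b} \<Longrightarrow> M u \<le> K"
    unfolding bdd_above_def by (metis imageI)
  have b: "\<bar>\<alpha> * X u + \<beta> * Y u\<bar> \<le> K * (\<bar>X u\<bar> + \<bar>Y u\<bar>)"
    if "\<bar>\<alpha>\<bar> \<le> M u" "\<bar>\<beta>\<bar> \<le> M u" "a < u" "u < b" for \<alpha> \<beta> u
  proof -
    have "\<bar>\<alpha>\<bar> \<le> K" "\<bar>\<beta>\<bar> \<le> K" using K[of u] that by auto
    then have "\<bar>\<alpha>\<bar> * \<bar>X u\<bar> + \<bar>\<beta>\<bar> * \<bar>Y u\<bar> \<le> K * \<bar>X u\<bar> + K * \<bar>Y u\<bar>"
      by (intro add_mono mult_right_mono) auto
    then show ?thesis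
      using abs_triangle_ineq[of "\<alpha> * X u" "\<beta> * Y u"] by (simp add: abs_mult distrib_left)
  qed
  show ?thesis
    by (rule ode_pair_zero[OF cont der _ _ c u, where K = K]) (auto intro!: b simp: M_def)
qed

subsection \<open>The meridian curve\<close>

lemma has_real_derivative_interior:
  fixes h :: "real \<Rightarrow> real"
  assumes "(h has_real_derivative D) (at u within S)" "{a..b} \<subseteq> S" "a < u" "u < b"
  shows "(h has_real_derivative D) (at u)"
proof -
  have "(h has_real_derivative D) (at u within {a<..<b})"
    using assms(2) by (intro DERIV_subset[OF assms(1)]) auto
  then show ?thesis using assms(3,4) at_within_open[of u "{a<..<b}"] by auto
qed

lemma smooth_on_real_derivative:
  fixes h :: "real \<Rightarrow> real"
  assumes "interval_dom S" "smooth_on S h" "x \<in> S"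
  shows "(h has_real_derivative vderiv S h x) (at x within S)"
  using smooth_on_has_vderiv[OF assms]
  by (simp add: has_real_derivative_iff_has_vector_derivative)

lemma real_derivative_unique:
  fixes h :: "real \<Rightarrow> real"
  assumes "interval_dom S" "x \<in> S"
    and "(h has_real_derivative D) (at x within S)" "(h has_real_derivative E) (at x within S)"
  shows "D = E"
  using assms vector_derivative_unique_within[OF interval_dom_nontrivial[OF assms(1,2)]]
  by (auto simp: has_real_derivative_iff_has_vector_derivative)

lemma interval_dom_closed_segment:
  assumes "interval_dom S" "a \<in> S" "b \<in> S"
  shows "closed_segment a b \<subseteq> S"
  using assms interval_dom_convex closed_segment_subset by blast

lemma interval_dom_Icc:
  assumes "interval_dom S" "a \<in> S" "b \<in> S"
  shows "{a..b} \<subseteq> S"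
  using interval_dom_closed_segment[OF assms] by (cases "a \<le> b") (auto simp: closed_segment_eq_real_ivl)

lemma interval_dom_near:
  assumes "interval_dom S" "x \<in> S" "e > 0"
  obtains s where "s \<in> S" "s \<noteq> x" "\<bar>s - x\<bar> < e"
  using interval_dom_nontrivial[OF assms(1,2)] assms(3)
  by (auto simp: trivial_limit_within islimpt_approachable dist_real_def)

section \<open>The meridian functions \<open>A\<close>, \<open>B\<close> and the differential
  equation in terms of them\<close>

locale meridian_curve =
  fixes I :: "real set" and f g :: "real \<Rightarrow> real"
  assumes I: "interval_dom I" and sf: "smooth_on I f" and sg: "smooth_on I g"
    and pos: "\<And>u. u \<in> I \<Longrightarrow> f u > 0"
    and unit_speed: "\<And>u. u \<in> I \<Longrightarrow> (vderiv I f u)\<^sup>2 - (vderiv I g u)\<^sup>2 = 1"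
begin

abbreviation "f1 \<equiv> vderiv I f"
abbreviation "f2 \<equiv> vderiv I f1"
abbreviation "f3 \<equiv> vderiv I f2"
abbreviation "g1 \<equiv> vderiv I g"
abbreviation "g2 \<equiv> vderiv I g1"
abbreviation "g3 \<equiv> vderiv I g2"

text \<open>For a great circle these are the coefficients of \<open>l \<and> t\<close> and
  \<open>e4 \<and> t\<close> in the Laplacian. The terms with \<open>f1 u / f u\<close> stem from
  \<open>\<nabla>\<^sub>y y = - (f' / f) x\<close>, the term \<open>g1 u / (f u)\<^sup>2\<close>
  from the component \<open>- l\<close> of \<open>t'\<close>.\<close>

definition "A u = - f3 u - f1 u * f2 u / f u"
definition "B u = - g3 u + g1 u / (f u)\<^sup>2 - f1 u * g2 u / f u"

lemmas smooth = sf sg smooth_on_vderiv[OF I]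

lemma smooth_derivs: "smooth_on I f1" "smooth_on I f2" "smooth_on I f3"
  "smooth_on I g1" "smooth_on I g2" "smooth_on I g3"
  by (intro smooth)+

lemma f_nonzero: "u \<in> I \<Longrightarrow> f u \<noteq> 0"
  using pos by fastforce

lemma smooth_A: "smooth_on I A"
  unfolding A_def [abs_def]
  by (intro smooth_on_diff smooth_on_minus smooth_on_divide smooth_on_mult I sf smooth_derivs f_nonzero)

lemma smooth_B: "smooth_on I B"
proof -
  have "smooth_on I (\<lambda>u. (f u)\<^sup>2)" by (intro smooth_on_power I sf)
  then show ?thesis unfolding B_def [abs_def]
    by (intro smooth_on_diff smooth_on_add smooth_on_minus smooth_on_divide smooth_on_mult
        I sf smooth_derivs f_nonzero) (auto dest: f_nonzero)
qed

lemmas dv = smooth_on_real_derivative[OF I]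
lemmas cont = smooth_on_continuous[OF I]

lemma f1_sq: "u \<in> I \<Longrightarrow> (f1 u)\<^sup>2 = 1 + (g1 u)\<^sup>2"
  using unit_speed[of u] by simp

lemma f1_nonzero: "u \<in> I \<Longrightarrow> f1 u \<noteq> 0"
  using f1_sq[of u] by (metis add_pos_nonneg less_irrefl zero_eq_power2 zero_le_power2 zero_less_one)

lemma speed_diff: assumes "u \<in> I" shows "f1 u * f2 u = g1 u * g2 u"
proof -
  have "((\<lambda>s. (f1 s)\<^sup>2 - (g1 s)\<^sup>2) has_real_derivative 2 * f1 u * f2 u - 2 * g1 u * g2 u) (at u within I)"
    by (auto intro!: derivative_eq_intros dv smooth_derivs assms)
  moreover have "((\<lambda>s. (f1 s)\<^sup>2 - (g1 s)\<^sup>2) has_real_derivative 0) (at u within I)"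
    by (rule has_field_derivative_transform_within[OF DERIV_const[of 1] zero_less_one assms])
      (simp add: unit_speed)
  ultimately show ?thesis using real_derivative_unique[OF I assms] by fastforce
qed

lemma speed_diff2: assumes "u \<in> I" shows "f1 u * f3 u + (f2 u)\<^sup>2 = g1 u * g3 u + (g2 u)\<^sup>2"
proof -
  have "((\<lambda>s. f1 s * f2 s - g1 s * g2 s) has_real_derivative
      (f1 u * f3 u + f2 u * f2 u) - (g1 u * g3 u + g2 u * g2 u)) (at u within I)"
    by (auto intro!: derivative_eq_intros dv smooth_derivs assms)
  moreover have "((\<lambda>s. f1 s * f2 s - g1 s * g2 s) has_real_derivative 0) (at u within I)"
    by (rule has_field_derivative_transform_within[OF DERIV_const[of 0] zero_less_one assms])
      (simp add: speed_diff)
  ultimately have "(f1 u * f3 u + f2 u * f2 u) - (g1 u * g3 u + g2 u * g2 u) = 0"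
    using real_derivative_unique[OF I assms] by blast
  then show ?thesis by (simp add: power2_eq_square)
qed

lemma vderiv_f_f2: assumes "u \<in> I"
  shows "vderiv I (\<lambda>s. f s * f2 s) u = f1 u * f2 u + f u * f3 u"
proof (rule vderiv_eqI[OF I assms refl])
  show "((\<lambda>s. f s * f2 s) has_vector_derivative f1 u * f2 u + f u * f3 u) (at u within I)"
    unfolding has_real_derivative_iff_has_vector_derivative[symmetric]
    by (auto intro!: derivative_eq_intros dv sf smooth_derivs assms)
qed

lemma f_sq_B: "u \<in> I \<Longrightarrow> (f u)\<^sup>2 * B u = - (f u)\<^sup>2 * g3 u + g1 u - f u * f1 u * g2 u"
  using f_nonzero[of u] by (simp add: B_def field_simps power2_eq_square)

lemma f_A: "u \<in> I \<Longrightarrow> f u * A u = - f u * f3 u - f1 u * f2 u"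
  using f_nonzero[of u] by (simp add: A_def field_simps)

text \<open>The first two derivatives of the unit-speed relation trade \<open>f''\<close> and
  \<open>f'''\<close> for \<open>g''\<close> and \<open>g'''\<close>. Together with the formula for
  \<open>ode_num\<close>, the argument of the logarithm becomes
  \<open>\<bar>g'\<bar> (A g' - B f') / B\<close>.\<close>

lemma ode_den_eq: assumes "u \<in> I" shows "ode_den I f u = (f u)\<^sup>2 * (g1 u) ^ 3 * B u"
proof -
  have "ode_den I f u = (g1 u)^4 + (f u)\<^sup>2 * (f2 u)\<^sup>2 - f u * f1 u * (g1 u)\<^sup>2 * (f1 u * f2 u + f u * f3 u)"
    unfolding ode_den_def Let_def vderiv_f_f2[OF assms] by (simp add: f1_sq[OF assms])
  then show ?thesis
    using f_sq_B[OF assms] speed_diff[OF assms] speed_diff2[OF assms] f1_sq[OF assms] by algebra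
qed

lemma ode_num_eq: assumes "u \<in> I"
  shows "ode_num I f u = (f u)\<^sup>2 * (g1 u) ^ 3 * (A u * g1 u - B u * f1 u)"
proof -
  have "ode_num I f u = f u * (g1 u)\<^sup>2 * (f1 u * f2 u + f u * f3 u) - (f u)\<^sup>2 * f1 u * (f2 u)\<^sup>2 - f1 u * (g1 u)^4"
    unfolding ode_num_def Let_def vderiv_f_f2[OF assms] by (simp add: f1_sq[OF assms])
  then show ?thesis
    using f_sq_B[OF assms] f_A[OF assms] speed_diff[OF assms] speed_diff2[OF assms] f1_sq[OF assms] by algebra
qed

text \<open>Substituting \<open>L g'\<close> for \<open>B\<close> turns the definition of
  \<open>B\<close> into a linear second-order equation for \<open>g'\<close> with zero initial data
  at \<open>c\<close>. A multiplier thus allows a double zero only if \<open>g'\<close> vanishes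
  identically.\<close>

lemma g_zero_everywhere:
  assumes L: "continuous_on I L" "\<And>u. u \<in> I \<Longrightarrow> B u = L u * g1 u"
    and c: "c \<in> I" "g1 c = 0" "g2 c = 0" and u: "u \<in> I"
  shows "g1 u = 0"
proof -
  define a b where "a = min c u" and "b = max c u"
  have sub: "{a..b} \<subseteq> I" and mem: "c \<in> {a..b}" "u \<in> {a..b}"
    using interval_dom_Icc[OF I] c u by (auto simp: a_def b_def min_def max_def)
  have *: "g1 u = 0 \<and> g2 u = 0"
  proof (rule linear_ode_pair_zero[where X = g1 and Y = g2 and p = "\<lambda>_. 0" and q = "\<lambda>_. 1" and c = c
        and r = "\<lambda>u. 1 / (f u)\<^sup>2 - L u" and s = "\<lambda>u. - (f1 u / f u)"])
    show "continuous_on {a..b} (\<lambda>u. 1 / (f u)\<^sup>2 - L u)" "continuous_on {a..b} (\<lambda>u. - (f1 u / f u))"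
      using sub f_nonzero by (auto intro!: continuous_intros continuous_on_subset[OF L(1)]
          continuous_on_subset[OF cont[OF sf]] continuous_on_subset[OF cont[OF smooth_derivs(1)]])
    show "continuous_on {a..b} g1" "continuous_on {a..b} g2"
      using sub continuous_on_subset cont smooth_derivs by blast+
    show "(g1 has_real_derivative 0 * g1 u + 1 * g2 u) (at u)" if "a < u" "u < b" for u
    proof -
      have "u \<in> I" using sub that by auto
      then show ?thesis using has_real_derivative_interior[OF dv[OF smooth_derivs(4)] sub that] by simp
    qed
    show "(g2 has_real_derivative (1 / (f u)\<^sup>2 - L u) * g1 u + - (f1 u / f u) * g2 u) (at u)"
      if "a < u" "u < b" for u
    proof -
      have uI: "u \<in> I" using sub that by auto
      have "g3 u = (1 / (f u)\<^sup>2 - L u) * g1 u + - (f1 u / f u) * g2 u"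
        using L(2)[OF uI] by (simp add: B_def algebra_simps)
      then show ?thesis
        using has_real_derivative_interior[OF dv sub that] smooth_derivs uI by metis
    qed
  qed (use mem c in auto)
  then show ?thesis by simp
qed

text \<open>The factor \<lambda> is eliminated from \<open>A = \<lambda> (f' + p)\<close> and
  \<open>B = \<lambda> g'\<close> by cross-multiplication, so the relation makes sense also where
  \<open>g'\<close> or \<open>B\<close> vanishes.\<close>

definition "balanced p u \<longleftrightarrow> A u * g1 u = B u * (f1 u + p)"

lemma balanced_closed_segment:
  assumes ab: "a \<in> I" "b \<in> I" "a \<noteq> b"
    and bal: "\<And>u. u \<in> open_segment a b \<Longrightarrow> balanced p u"
    and u: "u \<in> closed_segment a b"
  shows "balanced p u"
proof -
  have sub: "closed_segment a b \<subseteq> I" using interval_dom_closed_segment I ab by blast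
  let ?F = "\<lambda>u. A u * g1 u - B u * (f1 u + p)"
  have "continuous_on I ?F"
    by (intro continuous_intros cont smooth_A smooth_B smooth_derivs)
  then have "continuous_on (closure (open_segment a b)) ?F"
    using continuous_on_subset sub ab(3) by (simp add: closure_open_segment) blast
  then have "?F u = 0"
    by (rule continuous_constant_on_closure)
      (use bal u ab(3) in \<open>auto simp: balanced_def closure_open_segment\<close>)
  then show ?thesis by (simp add: balanced_def)
qed

text \<open>The balance relation is differentiated at \<open>c\<close> from the side of
  \<open>u\<close>; unit speed gives \<open>f2 c = 0\<close>, and \<open>g1 c = 0\<close> removes
  the other unwanted term. Unit speed also gives \<open>f1 c * f3 c = (g2 c)\<^sup>2\<close>, so
  \<open>A c = - f3 c\<close> is non-zero and the second identity fixes \<open>p\<close>.\<close>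

lemma balanced_at_simple_zero:
  assumes c: "c \<in> I" "g1 c = 0" "g2 c \<noteq> 0" and u: "u \<in> I" "u \<noteq> c"
    and bal: "\<And>s. s \<in> closed_segment c u \<Longrightarrow> balanced p s"
  shows "A c \<noteq> 0" "vderiv I B c * (f1 c + p) = A c * g2 c"
proof -
  have f2: "f2 c = 0" using speed_diff[OF c(1)] f1_nonzero[OF c(1)] c(2) by simp
  then show "A c \<noteq> 0"
    using speed_diff2[OF c(1)] c f1_nonzero[OF c(1)] by (auto simp: A_def)
  let ?T = "closed_segment c u"
  let ?F = "\<lambda>s. A s * g1 s - B s * (f1 s + p)"
  have sub: "?T \<subseteq> I" using interval_dom_closed_segment I c u by blast
  have T: "interval_dom ?T"
    using u(2) by (auto simp: interval_dom_def is_interval_convex closed_segment_eq_real_ivl)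
  have "(?F has_real_derivative
      (A c * g2 c + vderiv I A c * g1 c) - (B c * f2 c + vderiv I B c * (f1 c + p))) (at c within I)"
    by (auto intro!: derivative_eq_intros dv smooth_A smooth_B smooth_derivs c)
  then have 1: "(?F has_real_derivative A c * g2 c - vderiv I B c * (f1 c + p)) (at c within ?T)"
    using DERIV_subset sub by (simp add: f2 c(2)) blast
  have "(?F has_real_derivative 0) (at c within ?T)"
    by (rule has_field_derivative_transform_within[OF DERIV_const[of 0] zero_less_one])
      (use bal in \<open>auto simp: balanced_def\<close>)
  with real_derivative_unique[OF T _ 1] show "vderiv I B c * (f1 c + p) = A c * g2 c" by fastforce
qed

text \<open>At a common zero of \<open>g'\<close> and \<open>g''\<close> the balance equation can be solved for \<open>g'''\<close> when
  \<open>f' + p \<noteq> 0\<close>. In the remaining case \<open>p = - e\<close> with \<open>e = f' = \<plusminus>1\<close> at the zero, it is a regular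
  linear system for \<open>Y = g' (e f' - 1)\<close> and \<open>\<psi> = (1 - e / f') g''\<close>.\<close>

lemma balanced_double_zero:
  assumes ab: "a < b" "{a..b} \<subseteq> I" and c: "c \<in> {a..b}" "g1 c = 0" "g2 c = 0"
    and bal: "\<And>u. u \<in> {a..b} \<Longrightarrow> balanced p u"
  shows "\<exists>u. a < u \<and> u < b \<and> g1 u = 0 \<and> g2 u = 0"
proof (cases "f1 c + p = 0")
  case False
  have cI: "c \<in> I" using ab c by auto
  have "continuous_on {a..b} (\<lambda>u. f1 u + p)"
    by (intro continuous_intros continuous_on_subset[OF cont ab(2)] smooth_derivs)
  then have "\<forall>\<^sub>F u in at c within {a..b}. f1 u + p \<noteq> 0"
    using c(1) False tendsto_imp_eventually_ne continuous_on_def by metis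
  then obtain d where d: "d > 0" "\<And>u. u \<in> {a..b} \<Longrightarrow> u \<noteq> c \<Longrightarrow> \<bar>u - c\<bar> < d \<Longrightarrow> f1 u + p \<noteq> 0"
    by (auto simp: eventually_at dist_real_def)
  define a' where "a' = max a (c - d / 2)"
  define b' where "b' = min b (c + d / 2)"
  have ab': "a' < b'" "a \<le> a'" "b' \<le> b" "c \<in> {a'..b'}" using ab c d by (auto simp: a'_def b'_def)
  have nz: "f1 u + p \<noteq> 0" if "u \<in> {a'..b'}" for u
  proof (cases "u = c")
    case True
    then show ?thesis using False by simp
  next
    case u: False
    have "\<bar>u - c\<bar> < d" "u \<in> {a..b}" using that d(1) ab' by (auto simp: a'_def b'_def abs_if)
    then show ?thesis using d(2) u by blast
  qed
  have sub: "{a'..b'} \<subseteq> I" using ab ab' by auto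
  define m where "m = (a' + b') / 2"
  have m: "a' < m" "m < b'" using ab' by (auto simp: m_def)
  have "g1 m = 0 \<and> g2 m = 0"
  proof (rule linear_ode_pair_zero[where X = g1 and Y = g2 and p = "\<lambda>_. 0" and q = "\<lambda>_. 1" and c = c
        and r = "\<lambda>u. 1 / (f u)\<^sup>2 - A u / (f1 u + p)" and s = "\<lambda>u. - (f1 u / f u)" and a = a' and b = b'])
    show "continuous_on {a'..b'} (\<lambda>u. 1 / (f u)\<^sup>2 - A u / (f1 u + p))"
      "continuous_on {a'..b'} (\<lambda>u. - (f1 u / f u))"
    proof -
      have *: "continuous_on {a'..b'} f" "continuous_on {a'..b'} f1" "continuous_on {a'..b'} A"
        by (intro continuous_on_subset[OF cont sub] sf smooth_A smooth_derivs)+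
      show "continuous_on {a'..b'} (\<lambda>u. 1 / (f u)\<^sup>2 - A u / (f1 u + p))"
        "continuous_on {a'..b'} (\<lambda>u. - (f1 u / f u))"
        using f_nonzero sub nz by (auto intro!: continuous_intros * )
    qed
    show "continuous_on {a'..b'} g1" "continuous_on {a'..b'} g2"
      by (intro continuous_on_subset[OF cont sub] smooth_derivs)+
    fix u assume u: "a' < u" "u < b'"
    then have uI: "u \<in> I" using sub by auto
    show "(g1 has_real_derivative 0 * g1 u + 1 * g2 u) (at u)"
      using has_real_derivative_interior[OF dv[OF smooth_derivs(4) uI] sub u] by simp
    have "B u = A u / (f1 u + p) * g1 u"
      using bal[of u] nz[of u] u ab' by (auto simp: balanced_def field_simps)
    then have "g3 u = (1 / (f u)\<^sup>2 - A u / (f1 u + p)) * g1 u + - (f1 u / f u) * g2 u"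
      by (simp add: B_def algebra_simps)
    then show "(g2 has_real_derivative (1 / (f u)\<^sup>2 - A u / (f1 u + p)) * g1 u + - (f1 u / f u) * g2 u) (at u)"
      using has_real_derivative_interior[OF dv[OF smooth_derivs(5) uI] sub u] by simp
  qed (use m c ab' in auto)
  then show ?thesis using m ab' by (intro exI[of _ m]) auto
next
  case True
  define e where "e = f1 c"
  have cI: "c \<in> I" using ab c by auto
  have e: "e * e = 1" "p = - e"
    using f1_sq[OF cI] c True by (auto simp: e_def power2_eq_square)
  \<comment> \<open>With \<open>e f' = cosh \<theta>\<close> and \<open>g' = sinh \<theta>\<close>
    these are \<open>sinh \<theta> (cosh \<theta> - 1)\<close> and
    \<open>(cosh \<theta> - 1) \<theta>'\<close>. The balance relation has
    \<open>cosh \<theta> - 1\<close> in front of \<open>\<theta>''\<close>, which vanishes at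
    \<open>c\<close>; absorbing this factor into the unknowns removes the singularity.\<close>
  define Y where "Y u = g1 u * (e * f1 u - 1)" for u
  define \<psi> where "\<psi> u = (1 - e / f1 u) * g2 u" for u
  have YZ: "Y u = 0 \<and> \<psi> u = 0" if "u \<in> {a..b}" for u
  proof (rule linear_ode_pair_zero[where X = Y and Y = \<psi> and p = "\<lambda>_. 0" and q = "\<lambda>u. 2 * e * f1 u + 1"
        and r = "\<lambda>u. - (1 / (f u)\<^sup>2)" and s = "\<lambda>u. - (f1 u / f u)"])
    show "continuous_on {a..b} (\<lambda>u. - (1 / (f u)\<^sup>2))" "continuous_on {a..b} (\<lambda>u. - (f1 u / f u))"
      "continuous_on {a..b} (\<lambda>u. 2 * e * f1 u + 1)"
      "continuous_on {a..b} Y" "continuous_on {a..b} \<psi>"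
    proof -
      have *: "continuous_on {a..b} f" "continuous_on {a..b} f1"
        "continuous_on {a..b} g1" "continuous_on {a..b} g2"
        by (intro continuous_on_subset[OF cont ab(2)] sf smooth_derivs)+
      show "continuous_on {a..b} (\<lambda>u. - (1 / (f u)\<^sup>2))" "continuous_on {a..b} (\<lambda>u. - (f1 u / f u))"
        "continuous_on {a..b} (\<lambda>u. 2 * e * f1 u + 1)"
        "continuous_on {a..b} Y" "continuous_on {a..b} \<psi>"
        using f_nonzero f1_nonzero ab(2) unfolding Y_def \<psi>_def
        by (auto intro!: continuous_intros * )
    qed
    show "c \<in> {a..b}" "Y c = 0" "\<psi> c = 0" using c by (auto simp: Y_def \<psi>_def)
    show "u \<in> {a..b}" by fact
    fix u assume u: "a < u" "u < b"
    then have uI: "u \<in> I" and ul: "u \<in> {a..b}" using ab by auto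
    note nz = f_nonzero[OF uI] f1_nonzero[OF uI]
    note eqs = speed_diff[OF uI] speed_diff2[OF uI] f1_sq[OF uI] e(1)
    have "(Y has_real_derivative g1 u * (e * f2 u) + g2 u * (e * f1 u - 1)) (at u within I)"
      unfolding Y_def by (auto intro!: derivative_eq_intros dv smooth_derivs uI)
    moreover have "g1 u * (e * f2 u) + g2 u * (e * f1 u - 1) = 0 * Y u + (2 * e * f1 u + 1) * \<psi> u"
    proof -
      have p: "f1 u * \<psi> u = (f1 u - e) * g2 u" using nz by (simp add: \<psi>_def field_simps)
      have "f1 u * (g1 u * (e * f2 u) + g2 u * (e * f1 u - 1)) = f1 u * (0 * Y u + (2 * e * f1 u + 1) * \<psi> u)"
        using eqs p by algebra
      then show ?thesis using nz by simp
    qed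
    ultimately show "(Y has_real_derivative 0 * Y u + (2 * e * f1 u + 1) * \<psi> u) (at u)"
      using has_real_derivative_interior[OF _ ab(2) u] by metis
    define D where "D = (1 - e / f1 u) * g3 u + e * f2 u / (f1 u)\<^sup>2 * g2 u"
    have "(\<psi> has_real_derivative D) (at u within I)"
      unfolding \<psi>_def D_def using nz
      by (auto intro!: derivative_eq_intros dv smooth_derivs uI simp: power2_eq_square)
    moreover have "D = - (1 / (f u)\<^sup>2) * Y u + - (f1 u / f u) * \<psi> u"
    proof -
      have D: "(f1 u)\<^sup>2 * D = f1 u * (f1 u - e) * g3 u + e * f2 u * g2 u"
        using nz by (simp add: D_def field_simps power2_eq_square)
      have p: "f1 u * \<psi> u = (f1 u - e) * g2 u" using nz by (simp add: \<psi>_def field_simps)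
      have bl: "A u * g1 u = B u * (f1 u - e)"
        using bal[OF ul] by (simp add: balanced_def e)
      have "(f u)\<^sup>2 * (A u * g1 u) = (f u)\<^sup>2 * (B u * (f1 u - e))" using bl by simp
      then have E1: "f u * (- f u * f3 u - f1 u * f2 u) * g1 u
          = (- (f u)\<^sup>2 * g3 u + g1 u - f u * f1 u * g2 u) * (f1 u - e)"
        using f_A[OF uI] f_sq_B[OF uI] by algebra
      have "(f u)\<^sup>2 * (f1 u)\<^sup>2 * D = (f u)\<^sup>2 * (f1 u)\<^sup>2 * (- (1 / (f u)\<^sup>2) * Y u + - (f1 u / f u) * \<psi> u)"
      proof -
        have r: "(f u)\<^sup>2 * (- (1 / (f u)\<^sup>2) * Y u + - (f1 u / f u) * \<psi> u) = - Y u - f u * (f1 u * \<psi> u)"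
          using nz by (simp add: field_simps power2_eq_square)
        have "(f u)\<^sup>2 * ((f1 u)\<^sup>2 * D) = (f1 u)\<^sup>2 * (- Y u - f u * (f1 u * \<psi> u))"
          unfolding D p Y_def using eqs E1 nz by algebra
        then show ?thesis using r by algebra
      qed
      then show ?thesis using nz by simp
    qed
    ultimately show "(\<psi> has_real_derivative - (1 / (f u)\<^sup>2) * Y u + - (f1 u / f u) * \<psi> u) (at u)"
      using has_real_derivative_interior[OF _ ab(2) u] by metis
  qed auto
  have g0: "g1 u = 0" if "u \<in> {a..b}" for u
  proof (rule ccontr)
    assume n: "g1 u \<noteq> 0"
    have "u \<in> I" using that ab by auto
    moreover have "e * f1 u = 1" using YZ[OF that] n by (simp add: Y_def)
    ultimately show False using f1_sq[of u] e n
      by (metis add_cancel_right_right mult.commute mult_cancel_left2 power2_eq_square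
          mult.left_commute mult.right_neutral zero_eq_power2)
  qed
  define m where "m = (a + b) / 2"
  have m: "a < m" "m < b" using ab by (auto simp: m_def)
  then have mI: "m \<in> I" using ab by auto
  have "(g1 has_real_derivative g2 m) (at m)"
    using has_real_derivative_interior[OF dv[OF smooth_derivs(4) mI] ab(2) m] .
  then have "g2 m = 0"
    by (rule DERIV_local_const[of _ _ _ "min (m - a) (b - m)"]) (use m g0 in \<open>auto simp: abs_if split: if_splits\<close>)
  then show ?thesis using m g0[of m] by auto
qed

end

lemma ln_abs_real: "ln \<bar>x\<bar> = ln (x :: real)"
  by (simp add: abs_if ln_minus)

section \<open>Simple zeros of \<open>g'\<close> and the local constant \<open>p\<close>\<close>

context meridian_curve
begin

definition "regular u \<longleftrightarrow> u \<in> I \<and> (g1 u \<noteq> 0 \<or> g2 u \<noteq> 0)"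

text \<open>At a simple zero the difference quotient of \<open>g1\<close> tends to
  \<open>g2 u\<close>, so the zero is isolated.\<close>

lemma eventually_g1_nonzero:
  assumes "regular u"
  shows "\<forall>\<^sub>F s in at u within I. g1 s \<noteq> 0"
proof (cases "g1 u = 0")
  case False
  have "u \<in> I" using assms by (simp add: regular_def)
  then have "(g1 \<longlongrightarrow> g1 u) (at u within I)"
    using cont[OF smooth_derivs(4)] by (simp add: continuous_on_def)
  then show ?thesis using False by (rule tendsto_imp_eventually_ne)
next
  case True
  then have u: "u \<in> I" "g2 u \<noteq> 0" using assms by (auto simp: regular_def)
  have "((\<lambda>s. (g1 s - g1 u) / (s - u)) \<longlongrightarrow> g2 u) (at u within I)"
    using dv[OF smooth_derivs(4) u(1)] by (simp add: has_field_derivative_iff)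
  then have "\<forall>\<^sub>F s in at u within I. (g1 s - g1 u) / (s - u) \<noteq> 0"
    using u(2) by (rule tendsto_imp_eventually_ne)
  then show ?thesis by eventually_elim (use True in auto)
qed

text \<open>At a simple zero of \<open>g'\<close> both sides of the balance relation can vanish for
  every \<open>p\<close>, so the constant is recorded through a whole neighbourhood.\<close>

definition "germ p u \<longleftrightarrow> (\<exists>d>0. \<forall>s\<in>I. \<bar>s - u\<bar> < d \<longrightarrow> balanced p s)"

end

section \<open>From the differential equation to a smooth multiplier\<close>

locale meridian_curve_ode = meridian_curve +
  assumes ode: "meridian_ode I f"
begin

lemma w_nonzero_iff: "u \<in> I \<Longrightarrow> (f1 u)\<^sup>2 \<noteq> 1 \<longleftrightarrow> g1 u \<noteq> 0"
  using f1_sq[of u] by simp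

lemma B_nonzero: assumes "u \<in> I" "g1 u \<noteq> 0" shows "B u \<noteq> 0"
  using ode assms w_nonzero_iff[OF assms(1)] ode_den_eq[OF assms(1)] by (auto simp: meridian_ode_def)

definition "ratio u = (A u * g1 u - B u * f1 u) / B u"

lemma ratio_nonzero: assumes "u \<in> I" "g1 u \<noteq> 0" shows "ratio u \<noteq> 0"
  using ode assms w_nonzero_iff[OF assms(1)] ode_num_eq[OF assms(1)] B_nonzero[OF assms]
  by (auto simp: meridian_ode_def ratio_def)

lemma balanced_ratio: assumes "u \<in> I" "g1 u \<noteq> 0" shows "balanced p u \<longleftrightarrow> p = ratio u"
  using B_nonzero[OF assms] by (auto simp: balanced_def ratio_def field_simps)

text \<open>The equation differentiates \<open>ln (\<bar>g'\<bar> \<bar>ratio\<bar>)\<close>, and by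
  \<open>f' f'' = g' g''\<close> its right-hand side is \<open>g'' / g'\<close>. The contribution of
  \<open>ratio\<close> therefore has to vanish.\<close>

lemma ratio_deriv: assumes u: "u \<in> I" "g1 u \<noteq> 0"
  shows "(ratio has_real_derivative 0) (at u within I)"
proof -
  define r' where "r' = ((vderiv I A u * g1 u + A u * g2 u - (vderiv I B u * f1 u + B u * f2 u)) * B u
    - (A u * g1 u - B u * f1 u) * vderiv I B u) / (B u * B u)"
  have r': "(ratio has_real_derivative r') (at u within I)"
    unfolding ratio_def[abs_def] r'_def using B_nonzero[OF u]
    by (auto intro!: derivative_eq_intros dv smooth_A smooth_B smooth_derivs u simp: algebra_simps)
  have "\<forall>\<^sub>F s in at u within I. g1 s \<noteq> 0"
    using eventually_g1_nonzero u by (simp add: regular_def)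
  then obtain d where d: "d > 0" "\<And>s. s \<in> I \<Longrightarrow> s \<noteq> u \<Longrightarrow> \<bar>s - u\<bar> < d \<Longrightarrow> g1 s \<noteq> 0"
    by (auto simp: eventually_at dist_real_def)
  let ?L = "\<lambda>s. ln \<bar>sqrt ((f1 s)\<^sup>2 - 1) * ode_num I f s / ode_den I f s\<bar>"
  \<comment> \<open>Half the logarithms of squares replace logarithms of absolute values, so that
    the ordinary differentiation rules apply.\<close>
  let ?M = "\<lambda>s. (ln ((g1 s)\<^sup>2) + ln ((ratio s)\<^sup>2)) / 2"
  have LM: "?L s = ?M s" if s: "s \<in> I" "g1 s \<noteq> 0" for s
  proof -
    have "ode_num I f s / ode_den I f s = ratio s"
      using ode_num_eq[OF s(1)] ode_den_eq[OF s(1)] B_nonzero[OF s] s f_nonzero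
      by (simp add: ratio_def)
    then have "?L s = ln (\<bar>g1 s\<bar> * \<bar>ratio s\<bar>)"
      using f1_sq[OF s(1)] by (simp add: abs_mult times_divide_eq_right[symmetric] del: times_divide_eq_right)
    also have "\<dots> = ?M s"
      using s ratio_nonzero[OF s] by (simp add: ln_mult ln_abs_real power2_eq_square)
    finally show ?thesis .
  qed
  have "(?L has_real_derivative f1 u * f2 u / ((f1 u)\<^sup>2 - 1)) (at u within I)"
    using ode u w_nonzero_iff[OF u(1)] by (auto simp: meridian_ode_def)
  then have "(?M has_real_derivative f1 u * f2 u / ((f1 u)\<^sup>2 - 1)) (at u within I)"
    by (rule has_field_derivative_transform_within[OF _ d(1) u(1)])
      (use LM d(2) u in \<open>metis dist_real_def\<close>)
  moreover have "(?M has_real_derivative g2 u / g1 u + r' / ratio u) (at u within I)"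
    using u ratio_nonzero[OF u]
    by (auto intro!: derivative_eq_intros r' dv smooth_derivs
        simp: power2_eq_square divide_simps zero_less_mult_iff linorder_neq_iff)
  ultimately have "f1 u * f2 u / ((f1 u)\<^sup>2 - 1) = g2 u / g1 u + r' / ratio u"
    using real_derivative_unique[OF I u(1)] by blast
  moreover have "f1 u * f2 u / ((f1 u)\<^sup>2 - 1) = g2 u / g1 u"
    using speed_diff[OF u(1)] f1_sq[OF u(1)] u(2) by (simp add: power2_eq_square)
  ultimately have "r' = 0" using ratio_nonzero[OF u] by simp
  then show ?thesis using r' by simp
qed

lemma balanced_on_nonzero:
  assumes T: "convex T" "T \<subseteq> I" "T \<noteq> {}" "\<And>u. u \<in> T \<Longrightarrow> g1 u \<noteq> 0"
  shows "\<exists>p. p \<noteq> 0 \<and> (\<forall>u\<in>T. balanced p u)"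
proof -
  have "(ratio has_real_derivative 0) (at u within T)" if "u \<in> T" for u
    using DERIV_subset[OF ratio_deriv T(2)] T that by blast
  then obtain p where p: "\<And>u. u \<in> T \<Longrightarrow> ratio u = p"
    using has_field_derivative_zero_constant[OF T(1)] by metis
  have "p \<noteq> 0" using T p ratio_nonzero by blast
  moreover have "balanced p u" if "u \<in> T" for u
    using p balanced_ratio T that by blast
  ultimately show ?thesis by blast
qed

lemma regular_germ:
  assumes "regular u" shows "\<exists>p. p \<noteq> 0 \<and> germ p u"
proof -
  have u: "u \<in> I" using assms by (simp add: regular_def)
  obtain d where d: "d > 0" "\<And>s. s \<in> I \<Longrightarrow> s \<noteq> u \<Longrightarrow> \<bar>s - u\<bar> < d \<Longrightarrow> g1 s \<noteq> 0"
    using eventually_g1_nonzero[OF assms] by (auto simp: eventually_at dist_real_def)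
  show ?thesis
  proof (cases "g1 u = 0")
    case False
    let ?T = "I \<inter> ball u d"
    have "\<exists>p. p \<noteq> 0 \<and> (\<forall>u\<in>?T. balanced p u)"
    proof (rule balanced_on_nonzero)
      show "convex ?T" using interval_dom_convex[OF I] by (intro convex_Int) auto
      show "?T \<noteq> {}" using u d by auto
      show "g1 s \<noteq> 0" if "s \<in> ?T" for s
        using that d(2)[of s] False by (cases "s = u") (auto simp: dist_real_def abs_minus_commute)
    qed auto
    then obtain p where "p \<noteq> 0" "\<And>s. s \<in> I \<Longrightarrow> \<bar>s - u\<bar> < d \<Longrightarrow> balanced p s"
      by (auto simp: dist_real_def abs_minus_commute)
    then show ?thesis using d(1) by (auto simp: germ_def)
  next
    case True
    then have g2: "g2 u \<noteq> 0" using assms by (simp add: regular_def)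
    \<comment> \<open>The only value that the differentiated balance relation at \<open>u\<close>
      admits. It does not depend on \<open>s\<close>, so the constants found on the two sides of
      \<open>u\<close> coincide.\<close>
    define q where "q = A u * g2 u / vderiv I B u - f1 u"
    have bal: "q \<noteq> 0 \<and> balanced q s \<and> balanced q u" if s: "s \<in> I" "s \<noteq> u" "\<bar>s - u\<bar> < d" for s
    proof -
      have sub: "open_segment u s \<subseteq> I"
        using interval_dom_closed_segment[OF I u s(1)] segment_open_subset_closed by blast
      have "g1 x \<noteq> 0" if "x \<in> open_segment u s" for x
        using that sub s d(2)[of x] by (auto simp: open_segment_eq_real_ivl split: if_splits)
      then obtain p where p: "p \<noteq> 0" "\<And>x. x \<in> open_segment u s \<Longrightarrow> balanced p x"
        using balanced_on_nonzero[OF convex_open_segment sub] s(2) by (auto simp: open_segment_eq_real_ivl)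
      have cl: "balanced p x" if "x \<in> closed_segment u s" for x
        using balanced_closed_segment[OF u s(1) _ p(2) that] s(2) by auto
      have "vderiv I B u \<noteq> 0" "vderiv I B u * (f1 u + p) = A u * g2 u"
        using balanced_at_simple_zero[OF u True g2 s(1,2) cl] g2 by auto
      then have "p = q" by (simp add: q_def field_simps)
      then show ?thesis using p(1) cl by auto
    qed
    obtain s where "s \<in> I" "s \<noteq> u" "\<bar>s - u\<bar> < d"
      using interval_dom_near[OF I u d(1)] .
    then show ?thesis using bal d(1) by (metis germ_def)
  qed
qed

lemma germ_unique:
  assumes "regular u" "germ p u" "germ q u" shows "p = q"
proof -
  have u: "u \<in> I" using assms(1) by (simp add: regular_def)
  obtain d where d: "d > 0" "\<And>s. s \<in> I \<Longrightarrow> s \<noteq> u \<Longrightarrow> \<bar>s - u\<bar> < d \<Longrightarrow> g1 s \<noteq> 0"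
    using eventually_g1_nonzero[OF assms(1)] by (auto simp: eventually_at dist_real_def)
  obtain d1 d2 where dd: "d1 > 0" "d2 > 0" "\<And>s. s \<in> I \<Longrightarrow> \<bar>s - u\<bar> < d1 \<Longrightarrow> balanced p s"
    "\<And>s. s \<in> I \<Longrightarrow> \<bar>s - u\<bar> < d2 \<Longrightarrow> balanced q s"
    using assms by (auto simp: germ_def)
  obtain s where "s \<in> I" "s \<noteq> u" "\<bar>s - u\<bar> < min d (min d1 d2)"
    by (rule interval_dom_near[OF I u, of "min d (min d1 d2)"]) (use d(1) dd(1,2) in auto)
  then show ?thesis using dd d balanced_ratio by (metis min_less_iff_conj)
qed

text \<open>A germ at a point is also a germ at nearby points, and germs are unique at regular
  points; so the chosen \<open>P\<close> is locally constant on a connected set.\<close>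

lemma balanced_on_regular:
  assumes T: "convex T" "T \<noteq> {}" "\<And>u. u \<in> T \<Longrightarrow> regular u"
  shows "\<exists>p. p \<noteq> 0 \<and> (\<forall>u\<in>T. balanced p u)"
proof -
  define P where "P u = (SOME p. p \<noteq> 0 \<and> germ p u)" for u
  have P: "P u \<noteq> 0 \<and> germ (P u) u" if "u \<in> T" for u
    unfolding P_def using someI_ex[OF regular_germ[OF T(3)[OF that]]] .
  have eq: "P a = P b" if ab: "a \<in> T" "b \<in> T" for a b
  proof (rule connected_local_const[OF convex_connected[OF T(1)] ab], rule)
    fix u assume u: "u \<in> T"
    obtain d where d: "d > 0" "\<And>s. s \<in> I \<Longrightarrow> \<bar>s - u\<bar> < d \<Longrightarrow> balanced (P u) s"
      using P[OF u] by (auto simp: germ_def)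
    have "P u = P s" if s: "s \<in> T" "\<bar>s - u\<bar> < d" for s
    proof (rule germ_unique[OF T(3)[OF s(1)]])
      show "germ (P s) s" using P s by blast
      show "germ (P u) s" unfolding germ_def
        using d s(2) by (intro exI[of _ "d - \<bar>s - u\<bar>"]) (auto intro!: d(2))
    qed
    then show "\<forall>\<^sub>F s in at u within T. P u = P s"
      using d(1) by (auto simp: eventually_at dist_real_def)
  qed
  obtain c where c: "c \<in> T" using T by blast
  have "balanced (P c) u" if "u \<in> T" for u
  proof -
    have "germ (P c) u" using P[OF that] eq[OF c that] by simp
    then show ?thesis using T(3)[OF that] by (auto simp: germ_def regular_def)
  qed
  then show ?thesis using P c by blast
qed

text \<open>On the regular interior one constant \<open>p\<close> serves throughout, and by
  continuity the balance relation reaches the endpoint \<open>c\<close>. Then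
  \<open>balanced_double_zero\<close> produces a double zero strictly inside, against
  \<open>reg\<close>.\<close>

lemma no_double_zero:
  assumes ab: "a < b" "{a..b} \<subseteq> I" and c: "c \<in> {a, b}" "g1 c = 0" "g2 c = 0"
    and reg: "\<And>u. a < u \<Longrightarrow> u < b \<Longrightarrow> regular u"
  shows False
proof -
  have ne: "{a<..<b} \<noteq> {}" using ab(1) by simp
  have "\<exists>p. p \<noteq> 0 \<and> (\<forall>u\<in>{a<..<b}. balanced p u)"
    by (rule balanced_on_regular[OF _ ne]) (use reg in auto)
  then obtain p where p: "\<And>u. u \<in> {a<..<b} \<Longrightarrow> balanced p u" by blast
  have "a \<in> I" "b \<in> I" using ab by auto
  then have "balanced p u" if "u \<in> {a..b}" for u
    using balanced_closed_segment[of a b p u] p ab(1) that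
    by (auto simp: open_segment_eq_real_ivl closed_segment_eq_real_ivl)
  then show False
    using balanced_double_zero[OF ab _ c(2,3), of p] c(1) ab(1) reg by (auto simp: regular_def)
qed

text \<open>Density supplies a point \<open>u0\<close> with \<open>g' \<noteq> 0\<close>. Among the
  common zeros of \<open>g'\<close> and \<open>g''\<close> between \<open>u0\<close> and a supposed
  irregular point, compactness gives one closest to \<open>u0\<close>; the gap between the two
  contradicts \<open>no_double_zero\<close>.\<close>

lemma all_regular: assumes "u \<in> I" shows "regular u"
proof (rule ccontr)
  assume not: "\<not> regular u"
  obtain u0 where u0: "u0 \<in> I" "g1 u0 \<noteq> 0"
  proof -
    have "{u\<in>I. (f1 u)\<^sup>2 \<noteq> 1} \<noteq> {}" using ode assms unfolding meridian_ode_def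
      by (metis closure_empty empty_iff subsetD)
    then show ?thesis using that w_nonzero_iff by blast
  qed
  let ?Z = "\<lambda>a b. {s \<in> {a..b}. g1 s = 0} \<inter> {s \<in> {a..b}. g2 s = 0}"
  have cpt: "compact (?Z a b)" if "{a..b} \<subseteq> I" for a b
  proof -
    have c: "continuous_on {a..b} g1" "continuous_on {a..b} g2"
      by (intro continuous_on_subset[OF cont that] smooth_derivs)+
    then have "closed (?Z a b)"
      by (intro closed_Int continuous_closed_preimage_constant) auto
    then have "compact ({a..b} \<inter> ?Z a b)" by (intro compact_Int_closed) auto
    moreover have "{a..b} \<inter> ?Z a b = ?Z a b" by blast
    ultimately show ?thesis by simp
  qed
  have zu: "g1 u = 0" "g2 u = 0" using not assms by (auto simp: regular_def)
  consider "u < u0" | "u0 < u" using zu u0 by fastforce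
  then show False
  proof cases
    case 1
    have sub: "{u..u0} \<subseteq> I" using interval_dom_Icc[OF I assms u0(1)] .
    have "u \<in> ?Z u u0" using zu 1 by auto
    then have "?Z u u0 \<noteq> {}" by blast
    then obtain c where c: "c \<in> ?Z u u0" "\<And>s. s \<in> ?Z u u0 \<Longrightarrow> s \<le> c"
      using compact_attains_sup[OF cpt[OF sub]] by blast
    have "c \<noteq> u0" using c u0 by auto
    then show False
    proof (intro no_double_zero[of c u0 c])
      show "c < u0" "{c..u0} \<subseteq> I" "c \<in> {c, u0}" "g1 c = 0" "g2 c = 0"
        using c(1) sub \<open>c \<noteq> u0\<close> by auto
      show "regular s" if "c < s" "s < u0" for s
        using c(1) c(2)[of s] that sub by (auto simp: regular_def)
    qed
  next
    case 2
    have sub: "{u0..u} \<subseteq> I" using interval_dom_Icc[OF I u0(1) assms] .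
    have "u \<in> ?Z u0 u" using zu 2 by auto
    then have "?Z u0 u \<noteq> {}" by blast
    then obtain c where c: "c \<in> ?Z u0 u" "\<And>s. s \<in> ?Z u0 u \<Longrightarrow> c \<le> s"
      using compact_attains_inf[OF cpt[OF sub]] by blast
    have "c \<noteq> u0" using c u0 by auto
    then show False
    proof (intro no_double_zero[of u0 c c])
      show "u0 < c" "{u0..c} \<subseteq> I" "c \<in> {u0, c}" "g1 c = 0" "g2 c = 0"
        using c(1) sub \<open>c \<noteq> u0\<close> by auto
      show "regular s" if "u0 < s" "s < c" for s
        using c(1) c(2)[of s] that sub by (auto simp: regular_def)
    qed
  qed
qed

lemma multiplier_exists:
  "\<exists>p L. p \<noteq> 0 \<and> smooth_on I L \<and>
     (\<forall>u\<in>I. L u \<noteq> 0 \<and> A u = L u * (f1 u + p) \<and> B u = L u * g1 u)"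
proof -
  have Ine: "I \<noteq> {}" using I by (auto simp: interval_dom_def)
  obtain p where p: "p \<noteq> 0" "\<And>u. u \<in> I \<Longrightarrow> balanced p u"
    using balanced_on_regular[OF interval_dom_convex[OF I] Ine all_regular] by blast
  \<comment> \<open>Balance makes \<open>(A, B)\<close> parallel to \<open>(f' + p, g')\<close>, and
    \<open>L\<close> is the factor, obtained by projection instead of division by \<open>g'\<close>.
    The denominator \<open>N\<close> has no zero because \<open>f' + p \<noteq> 0\<close> wherever
    \<open>g' = 0\<close>.\<close>
  define N where "N u = (f1 u + p)\<^sup>2 + (g1 u)\<^sup>2" for u
  define L where "L u = (A u * (f1 u + p) + B u * g1 u) / N u" for u
  have zero: "A u \<noteq> 0 \<and> f1 u + p \<noteq> 0" if u: "u \<in> I" "g1 u = 0" for u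
  proof -
    have g2: "g2 u \<noteq> 0" using all_regular[OF u(1)] u by (simp add: regular_def)
    obtain s where s: "s \<in> I" "s \<noteq> u"
      using interval_dom_near[OF I u(1) zero_less_one] .
    have "balanced p x" if "x \<in> closed_segment u s" for x
      using interval_dom_closed_segment[OF I u(1) s(1)] p(2) that by blast
    from balanced_at_simple_zero[OF u g2 s this] g2 show ?thesis by auto
  qed
  have N: "N u \<noteq> 0" if "u \<in> I" for u
    using zero[OF that] by (auto simp: N_def sum_power2_eq_zero_iff)
  have "smooth_on I (\<lambda>u. (f1 u + p)\<^sup>2 + (g1 u)\<^sup>2)"
    by (intro smooth_on_add smooth_on_power smooth_on_const I smooth_derivs)
  then have "smooth_on I L" unfolding L_def[abs_def]
    by (intro smooth_on_divide smooth_on_add smooth_on_mult smooth_on_const I smooth_derivs smooth_A smooth_B)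
      (use N in \<open>auto simp: N_def[abs_def]\<close>)
  moreover have "L u \<noteq> 0 \<and> A u = L u * (f1 u + p) \<and> B u = L u * g1 u" if u: "u \<in> I" for u
  proof -
    have bl: "A u * g1 u = B u * (f1 u + p)" using p(2)[OF u] by (simp add: balanced_def)
    have "A u * N u = (A u * (f1 u + p) + B u * g1 u) * (f1 u + p)"
      "B u * N u = (A u * (f1 u + p) + B u * g1 u) * g1 u"
      unfolding N_def using bl by algebra+
    then have 1: "A u = L u * (f1 u + p)" "B u = L u * g1 u"
      using N[OF u] by (auto simp: L_def field_simps)
    moreover have "L u \<noteq> 0"
      using zero[OF u] B_nonzero[OF u] 1 by (cases "g1 u = 0") auto
    ultimately show ?thesis by blast
  qed
  ultimately show ?thesis using p(1) by blast
qed

end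

section \<open>From a multiplier back to the differential equation\<close>

context meridian_curve
begin

text \<open>Here \<open>ode_num\<close> is \<open>p\<close> times \<open>ode_den\<close>, so the
  logarithm is \<open>ln \<bar>g'\<bar>\<close> up to a constant and its derivative
  \<open>g'' / g'\<close> is the right-hand side. Density comes from
  \<open>g_zero_everywhere\<close>: all zeros of \<open>g'\<close> are simple, hence
  isolated.\<close>

lemma meridian_ode_if_multiplier:
  assumes p: "p \<noteq> 0" and L: "continuous_on I L" "\<And>u. u \<in> I \<Longrightarrow> L u \<noteq> 0"
    "\<And>u. u \<in> I \<Longrightarrow> A u = L u * (f1 u + p)" "\<And>u. u \<in> I \<Longrightarrow> B u = L u * g1 u"
    and nz: "u0 \<in> I" "g1 u0 \<noteq> 0"
  shows "meridian_ode I f"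
  unfolding meridian_ode_def
proof (intro conjI ballI impI subsetI)
  fix u assume u: "u \<in> I"
  then have reg: "regular u"
    using g_zero_everywhere[OF L(1,4), of u u0] nz by (auto simp: regular_def)
  have "\<exists>s\<in>{u \<in> I. (f1 u)\<^sup>2 \<noteq> 1}. dist s u < e" if e: "e > 0" for e
  proof -
    obtain d where d: "d > 0" "\<And>s. s \<in> I \<Longrightarrow> s \<noteq> u \<Longrightarrow> \<bar>s - u\<bar> < d \<Longrightarrow> g1 s \<noteq> 0"
      using eventually_g1_nonzero[OF reg] by (auto simp: eventually_at dist_real_def)
    obtain s where "s \<in> I" "s \<noteq> u" "\<bar>s - u\<bar> < min d e"
      by (rule interval_dom_near[OF I u, of "min d e"]) (use d(1) e in auto)
    then show ?thesis using d f1_sq[of s] by (auto simp: dist_real_def)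
  qed
  then show "u \<in> closure {u \<in> I. (f1 u)\<^sup>2 \<noteq> 1}" by (simp add: closure_approachable)
next
  fix u assume u: "u \<in> I" and w: "(f1 u)\<^sup>2 \<noteq> 1"
  have num: "ode_num I f s = p * ode_den I f s" if "s \<in> I" for s
    using ode_num_eq[OF that] ode_den_eq[OF that] L(3,4)[OF that] by (simp add: algebra_simps)
  have den: "ode_den I f s \<noteq> 0" if "s \<in> I" "g1 s \<noteq> 0" for s
    using ode_den_eq[OF that(1)] L(2,4)[OF that(1)] that f_nonzero by simp
  have g: "g1 u \<noteq> 0" using w f1_sq[OF u] by auto
  show "ode_den I f u \<noteq> 0" "ode_num I f u \<noteq> 0" using den[OF u g] num[OF u] p by auto
  obtain d where d: "d > 0" "\<And>s. s \<in> I \<Longrightarrow> s \<noteq> u \<Longrightarrow> \<bar>s - u\<bar> < d \<Longrightarrow> g1 s \<noteq> 0"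
    using eventually_g1_nonzero[of u] u g by (auto simp: eventually_at dist_real_def regular_def)
  have "((\<lambda>s. (ln ((g1 s)\<^sup>2) + ln (p\<^sup>2)) / 2) has_real_derivative g2 u / g1 u) (at u within I)"
    using u g p by (auto intro!: derivative_eq_intros dv smooth_derivs
        simp: power2_eq_square divide_simps zero_less_mult_iff linorder_neq_iff)
  moreover have "g2 u / g1 u = f1 u * f2 u / ((f1 u)\<^sup>2 - 1)"
    using speed_diff[OF u] f1_sq[OF u] g by (simp add: power2_eq_square)
  ultimately have "((\<lambda>s. (ln ((g1 s)\<^sup>2) + ln (p\<^sup>2)) / 2) has_real_derivative
      f1 u * f2 u / ((f1 u)\<^sup>2 - 1)) (at u within I)" by simp
  then show "((\<lambda>s. ln \<bar>sqrt ((f1 s)\<^sup>2 - 1) * ode_num I f s / ode_den I f s\<bar>)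
      has_real_derivative f1 u * f2 u / ((f1 u)\<^sup>2 - 1)) (at u within I)"
  proof (rule has_field_derivative_transform_within[OF _ d(1) u])
    fix s assume s: "s \<in> I" "dist s u < d"
    then have gs: "g1 s \<noteq> 0" using d(2)[of s] g by (cases "s = u") (auto simp: dist_real_def)
    have "sqrt ((f1 s)\<^sup>2 - 1) * ode_num I f s / ode_den I f s = \<bar>g1 s\<bar> * p"
      using num[OF s(1)] den[OF s(1) gs] f1_sq[OF s(1)] by simp
    then show "(ln ((g1 s)\<^sup>2) + ln (p\<^sup>2)) / 2 = ln \<bar>sqrt ((f1 s)\<^sup>2 - 1) * ode_num I f s / ode_den I f s\<bar>"
      using gs p by (simp add: ln_mult abs_mult ln_abs_real power2_eq_square)
  qed
qed

end

subsection \<open>The moving frame and the Laplacian of the Gauss map\<close>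

lemma inner_real4: "(a :: real ^ 4) \<bullet> b = a $ 1 * b $ 1 + a $ 2 * b $ 2 + a $ 3 * b $ 3 + a $ 4 * b $ 4"
  by (simp add: inner_vec_def sum_4)

lemma mink_inner: "mink a b = a \<bullet> b - 2 * (a $ 4) * (b $ 4)"
  by (simp add: mink_def inner_real4)

lemma mink_scaleR_left: "mink (c *\<^sub>R a) b = c * mink a b"
  by (simp add: mink_def algebra_simps)

lemma R3_component: "a \<in> R3 \<Longrightarrow> a $ 4 = 0"
  unfolding R3_def
  by (induction rule: span_induct) (auto simp: subspace_def axis_def)

abbreviation e4 :: "real ^ 4" where "e4 \<equiv> axis 4 1"

lemma inner_e4: "a \<bullet> e4 = a $ 4"
  by (rule cart_eq_inner_axis[symmetric])

lemma e4_4: "e4 $ 4 = 1"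
  by (simp add: axis_def)

lemma e4_inner: "e4 \<bullet> a = a $ 4"
  by (metis inner_commute inner_e4)

lemma bounded_bilinear_wedge: "bounded_bilinear wedge"
  unfolding bilinear_conv_bounded_bilinear[symmetric] bilinear_def wedge_def
  by (auto intro!: linearI simp: vec_eq_iff algebra_simps)

lemmas wedge_simps =
  bounded_bilinear.add_left[OF bounded_bilinear_wedge]
  bounded_bilinear.add_right[OF bounded_bilinear_wedge]
  bounded_bilinear.diff_left[OF bounded_bilinear_wedge]
  bounded_bilinear.diff_right[OF bounded_bilinear_wedge]
  bounded_bilinear.scaleR_left[OF bounded_bilinear_wedge]
  bounded_bilinear.scaleR_right[OF bounded_bilinear_wedge]
  bounded_bilinear.minus_left[OF bounded_bilinear_wedge]
  bounded_bilinear.minus_right[OF bounded_bilinear_wedge]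

lemma wedge_self [simp]: "wedge a a = 0"
  by (simp add: wedge_def vec_eq_iff)

lemma wedge_bivector: "wedge a b \<in> bivectors"
  by (simp add: bivectors_def wedge_def transpose_def vec_eq_iff)

lemma bivectors_component: "X \<in> bivectors \<longleftrightarrow> (\<forall>i j. X $ j $ i + X $ i $ j = 0)"
  unfolding bivectors_def transpose_def vec_eq_iff by (simp add: eq_neg_iff_add_eq_0)

lemma bivectors_add:
  assumes "X \<in> bivectors" "Y \<in> bivectors" shows "X + Y \<in> bivectors"
  unfolding bivectors_component
proof (intro allI)
  fix i j
  have "X $ j $ i + X $ i $ j = 0" "Y $ j $ i + Y $ i $ j = 0"
    using assms unfolding bivectors_component by blast+
  then show "(X + Y) $ j $ i + (X + Y) $ i $ j = 0"
    unfolding vector_add_component by linarith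
qed

lemma bivectors_scaleR:
  assumes "X \<in> bivectors" shows "c *\<^sub>R X \<in> bivectors"
  using assms unfolding bivectors_component vector_scaleR_component
  by (simp flip: distrib_left)

lemmas has_vector_derivative_wedge =
  bounded_bilinear.has_vector_derivative[OF bounded_bilinear_wedge]

lemmas has_vector_derivative_inner =
  bounded_bilinear.has_vector_derivative[OF bounded_bilinear_inner]

text \<open>The frame \<open>l, t, n, e4\<close> is orthonormal for the Euclidean product as well,
  so pairings \<open>a \<bullet> (C *v b)\<close> of frame vectors read off the coefficients of
  \<open>C\<close>.\<close>

lemma inner_wedge_mult: "a \<bullet> (wedge x y *v b) = (a \<bullet> x) * (y \<bullet> b) - (a \<bullet> y) * (x \<bullet> b)"
  by (simp add: inner_real4 matrix_vector_mult_def wedge_def sum_4 algebra_simps)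

lemma bivector_swap:
  assumes "C \<in> bivectors"
  shows "b \<bullet> (C *v a) = - (a \<bullet> (C *v b))"
proof -
  have "transpose C = - C" using assms by (simp add: bivectors_def)
  then have "b \<bullet> (C *v a) = - (b \<bullet> (transpose C *v a))"
    by (simp add: matrix_vector_mult_def inner_vec_def sum_negf)
  also have "b \<bullet> (transpose C *v a) = a \<bullet> (C *v b)"
    by (simp add: inner_commute[of b] dot_lmul_matrix)
  finally show ?thesis .
qed

lemma orthonormal_real4_expand:
  fixes a b c d x :: "real ^ 4"
  assumes "a \<bullet> a = 1" "b \<bullet> b = 1" "c \<bullet> c = 1" "d \<bullet> d = 1"
    and "a \<bullet> b = 0" "a \<bullet> c = 0" "a \<bullet> d = 0" "b \<bullet> c = 0" "b \<bullet> d = 0" "c \<bullet> d = 0"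
  shows "x = (x \<bullet> a) *\<^sub>R a + (x \<bullet> b) *\<^sub>R b + (x \<bullet> c) *\<^sub>R c + (x \<bullet> d) *\<^sub>R d"
proof -
  let ?B = "{a, b, c, d}"
  have ne: "a \<noteq> b" "a \<noteq> c" "a \<noteq> d" "b \<noteq> c" "b \<noteq> d" "c \<noteq> d" using assms by auto
  have orth: "pairwise orthogonal ?B"
    using assms by (auto simp: pairwise_def orthogonal_def inner_commute)
  have "0 \<notin> ?B" using assms by auto
  then have "independent ?B" using pairwise_orthogonal_independent orth by blast
  moreover have "card ?B = DIM(real ^ 4)" using ne by simp
  ultimately have "span ?B = UNIV"
    using card_ge_dim_independent[of ?B UNIV] by (auto simp: dim_UNIV)
  moreover have "norm v = 1" if "v \<in> ?B" for v
    using that assms by (auto simp: norm_eq_1)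
  ultimately have "(\<Sum>v\<in>?B. (x \<bullet> v) *\<^sub>R v) = x"
    using orthonormal_basis_expand[OF orth, of x] by auto
  then show ?thesis using ne by (simp add: add.assoc)
qed

section \<open>The Frenet frame of the spherical curve\<close>

locale elliptic_meridian =
  fixes I J :: "real set" and f g :: "real \<Rightarrow> real" and l n :: "real \<Rightarrow> real ^ 4"
  assumes data: "elliptic_meridian_data I J f g l n"

sublocale elliptic_meridian \<subseteq> meridian_curve I f g
  using data by unfold_locales (auto simp: elliptic_meridian_data_def)

context elliptic_meridian
begin

abbreviation "t \<equiv> vderiv J l"
abbreviation "\<kappa> \<equiv> spherical_curvature J l n"
abbreviation "\<kappa>' \<equiv> vderiv J \<kappa>"
abbreviation "z \<equiv> meridian_surface f g l"

lemma J: "interval_dom J" and sl: "smooth_on J l" and sn: "smooth_on J n"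
  using data by (auto simp: elliptic_meridian_data_def)

lemma st: "smooth_on J t" "smooth_on J (vderiv J t)" "smooth_on J (vderiv J n)"
  using smooth_on_vderiv J sl sn by blast+

lemmas dvJ = smooth_on_has_vderiv[OF J]

lemma vderiv_component_zero:
  fixes h :: "real \<Rightarrow> real ^ 4"
  assumes "v \<in> J" "smooth_on J h" "\<And>w. w \<in> J \<Longrightarrow> h w $ 4 = 0"
  shows "vderiv J h v $ 4 = 0"
proof -
  have "((\<lambda>w. h w \<bullet> e4) has_vector_derivative vderiv J h v \<bullet> e4) (at v within J)"
    using has_vector_derivative_inner[OF dvJ[OF assms(2,1)] has_vector_derivative_const[of e4]] by simp
  then have "vderiv J (\<lambda>w. h w \<bullet> e4) v = vderiv J h v \<bullet> e4"
    by (rule vderiv_eqI[OF J assms(1) refl])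
  moreover have "vderiv J (\<lambda>w. h w \<bullet> e4) v = 0"
    by (rule vderiv_eqI[OF J assms(1), of _ "\<lambda>_. 0"]) (auto simp: inner_e4 assms(3))
  ultimately show ?thesis by (simp add: inner_e4)
qed

lemma comp4: assumes "v \<in> J"
  shows "l v $ 4 = 0" "n v $ 4 = 0" "t v $ 4 = 0" "vderiv J t v $ 4 = 0" "vderiv J n v $ 4 = 0"
proof -
  have *: "l v $ 4 = 0" "n v $ 4 = 0" if "v \<in> J" for v
    using data that R3_component by (auto simp: elliptic_meridian_data_def)
  then show "l v $ 4 = 0" "n v $ 4 = 0" "vderiv J n v $ 4 = 0"
    using assms vderiv_component_zero sn by auto
  have **: "t v $ 4 = 0" if "v \<in> J" for v
    using * that vderiv_component_zero sl by auto
  then show "t v $ 4 = 0" "vderiv J t v $ 4 = 0"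
    using assms vderiv_component_zero st by auto
qed

lemma frame_inner: assumes "v \<in> J"
  shows "l v \<bullet> l v = 1" "t v \<bullet> t v = 1" "n v \<bullet> n v = 1" "n v \<bullet> l v = 0" "n v \<bullet> t v = 0"
    "l v \<bullet> n v = 0" "t v \<bullet> n v = 0"
    "l v \<bullet> e4 = 0" "t v \<bullet> e4 = 0" "n v \<bullet> e4 = 0" "e4 \<bullet> l v = 0" "e4 \<bullet> t v = 0" "e4 \<bullet> n v = 0"
    "e4 \<bullet> e4 = 1"
proof -
  have "mink (l v) (l v) = 1" "mink (t v) (t v) = 1" "mink (n v) (n v) = 1"
    "mink (n v) (l v) = 0" "mink (n v) (t v) = 0"
    using data assms by (auto simp: elliptic_meridian_data_def)
  then show "l v \<bullet> l v = 1" "t v \<bullet> t v = 1" "n v \<bullet> n v = 1" "n v \<bullet> l v = 0" "n v \<bullet> t v = 0"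
    "l v \<bullet> n v = 0" "t v \<bullet> n v = 0"
    unfolding mink_inner using comp4[OF assms] by (simp_all add: inner_commute)
qed (use comp4[OF assms] in \<open>simp_all only: inner_e4 e4_inner e4_4\<close>)

lemma inner_derivative:
  assumes "v \<in> J" "smooth_on J h" "smooth_on J k" "\<And>w. w \<in> J \<Longrightarrow> h w \<bullet> k w = c"
  shows "h v \<bullet> vderiv J k v + vderiv J h v \<bullet> k v = 0"
proof -
  have "((\<lambda>w. h w \<bullet> k w) has_vector_derivative h v \<bullet> vderiv J k v + vderiv J h v \<bullet> k v) (at v within J)"
    using has_vector_derivative_inner[OF dvJ[OF assms(2,1)] dvJ[OF assms(3,1)]] .
  then have "vderiv J (\<lambda>w. h w \<bullet> k w) v = h v \<bullet> vderiv J k v + vderiv J h v \<bullet> k v"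
    by (rule vderiv_eqI[OF J assms(1) refl])
  moreover have "vderiv J (\<lambda>w. h w \<bullet> k w) v = 0"
    by (rule vderiv_eqI[OF J assms(1), of _ "\<lambda>_. c"]) (auto simp: assms(4))
  ultimately show ?thesis by simp
qed

lemma l_inner_t: assumes "v \<in> J" shows "l v \<bullet> t v = 0" "t v \<bullet> l v = 0"
  using inner_derivative[OF assms sl sl frame_inner(1)] by (auto simp: inner_commute)

lemma curvature_inner: "v \<in> J \<Longrightarrow> \<kappa> v = vderiv J t v \<bullet> n v"
  using comp4 by (simp add: spherical_curvature_def mink_inner)

lemmas frame = frame_inner l_inner_t

lemma frame_expand: assumes "v \<in> J"
  shows "x = (x \<bullet> l v) *\<^sub>R l v + (x \<bullet> t v) *\<^sub>R t v + (x \<bullet> n v) *\<^sub>R n v + (x \<bullet> e4) *\<^sub>R e4"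
  by (rule orthonormal_real4_expand) (use frame[OF assms] in auto)

lemma frenet_t: assumes v: "v \<in> J" shows "vderiv J t v = \<kappa> v *\<^sub>R n v - l v"
proof -
  have "t v \<bullet> vderiv J t v = 0"
    using inner_derivative[OF v st(1) st(1) frame(2)] by (simp add: inner_commute)
  moreover have "l v \<bullet> vderiv J t v + t v \<bullet> t v = 0"
    by (rule inner_derivative[OF v sl st(1) l_inner_t(1)])
  ultimately have "vderiv J t v \<bullet> t v = 0" "vderiv J t v \<bullet> l v = - 1"
    using frame(2)[OF v] by (auto simp: inner_commute)
  moreover have "vderiv J t v \<bullet> e4 = 0" using comp4[OF v] by (simp add: inner_e4)
  ultimately show ?thesis
    using frame_expand[OF v, of "vderiv J t v"] curvature_inner[OF v] by simp
qed

lemma frenet_n: assumes v: "v \<in> J" shows "vderiv J n v = - \<kappa> v *\<^sub>R t v"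
proof -
  have "vderiv J n v \<bullet> n v = 0"
    using inner_derivative[OF v sn sn frame(3)] by (simp add: inner_commute)
  moreover have "n v \<bullet> t v + vderiv J n v \<bullet> l v = 0"
    by (rule inner_derivative[OF v sn sl frame(4)])
  moreover have "n v \<bullet> vderiv J t v + vderiv J n v \<bullet> t v = 0"
    by (rule inner_derivative[OF v sn st(1) frame(5)])
  ultimately have "vderiv J n v \<bullet> n v = 0" "vderiv J n v \<bullet> l v = 0" "vderiv J n v \<bullet> t v = - \<kappa> v"
    using frame[OF v] frenet_t[OF v] by (auto simp: inner_diff_right)
  moreover have "vderiv J n v \<bullet> e4 = 0" using comp4[OF v] by (simp add: inner_e4)
  ultimately show ?thesis using frame_expand[OF v, of "vderiv J n v"] by simp
qed

lemma deriv_l: "v \<in> J \<Longrightarrow> (l has_vector_derivative t v) (at v within J)"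
  using dvJ[OF sl] .

lemma deriv_t: "v \<in> J \<Longrightarrow> (t has_vector_derivative \<kappa> v *\<^sub>R n v - l v) (at v within J)"
  using dvJ[OF st(1)] frenet_t by metis

lemma deriv_n: "v \<in> J \<Longrightarrow> (n has_vector_derivative - \<kappa> v *\<^sub>R t v) (at v within J)"
  using dvJ[OF sn] frenet_n by metis

lemma deriv_kappa: assumes "v \<in> J" shows "(\<kappa> has_vector_derivative \<kappa>' v) (at v within J)"
proof -
  have *: "((\<lambda>w. vderiv J t w \<bullet> n w) has_vector_derivative
      vderiv J t v \<bullet> vderiv J n v + vderiv J (vderiv J t) v \<bullet> n v) (at v within J)"
    using has_vector_derivative_inner[OF dvJ[OF st(2) assms] dvJ[OF sn assms]] .
  have "\<kappa>' v = vderiv J t v \<bullet> vderiv J n v + vderiv J (vderiv J t) v \<bullet> n v"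
    by (intro vderiv_eqI[of J v \<kappa>, OF J assms _ *] curvature_inner)
  then show ?thesis
    using has_vector_derivative_transform[OF assms curvature_inner *] by simp
qed

section \<open>Derivatives of the tangent frame and of the Gauss map\<close>

lemma pd1_combination:
  fixes a b :: "real \<Rightarrow> real" and x y :: "'a :: real_normed_vector"
  assumes "u \<in> I" "smooth_on I a" "smooth_on I b" "\<And>s. s \<in> I \<Longrightarrow> F s v = a s *\<^sub>R x + b s *\<^sub>R y"
  shows "pd1 I F u v = vderiv I a u *\<^sub>R x + vderiv I b u *\<^sub>R y"
  unfolding pd1_def
  by (rule vderiv_eqI[OF I assms(1,4)])
    (auto intro!: derivative_eq_intros dv assms)

lemma frame_x_eq: "u \<in> I \<Longrightarrow> frame_x I z u v = f1 u *\<^sub>R l v + g1 u *\<^sub>R e4"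
  unfolding frame_x_def by (rule pd1_combination) (auto simp: meridian_surface_def sf sg)

lemma pd2_z: "v \<in> J \<Longrightarrow> pd2 J z u v = f u *\<^sub>R t v"
  unfolding pd2_def
  by (rule vderiv_eqI[OF J _ refl]) (auto simp: meridian_surface_def intro!: derivative_eq_intros deriv_l)

lemma frame_y_eq: "u \<in> I \<Longrightarrow> v \<in> J \<Longrightarrow> frame_y J f z u v = t v"
  by (simp add: frame_y_def pd2_z f_nonzero)

abbreviation "G \<equiv> gauss_map I J f z"

lemma G_eq: "u \<in> I \<Longrightarrow> v \<in> J \<Longrightarrow> G u v = f1 u *\<^sub>R wedge (l v) (t v) + g1 u *\<^sub>R wedge e4 (t v)"
  by (simp add: gauss_map_def frame_x_eq frame_y_eq wedge_simps)

lemma D_x_G: "u \<in> I \<Longrightarrow> v \<in> J \<Longrightarrow> D_x I G u v = f2 u *\<^sub>R wedge (l v) (t v) + g2 u *\<^sub>R wedge e4 (t v)"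
  unfolding D_x_def by (rule pd1_combination) (auto simp: G_eq smooth_derivs)

lemma D_xx_G: "u \<in> I \<Longrightarrow> v \<in> J \<Longrightarrow>
    D_x I (D_x I G) u v = f3 u *\<^sub>R wedge (l v) (t v) + g3 u *\<^sub>R wedge e4 (t v)"
  unfolding D_x_def[of I "D_x I G"] by (rule pd1_combination) (auto simp: D_x_G smooth_derivs)

lemma D_y_eqI:
  fixes F :: "real \<Rightarrow> real \<Rightarrow> 'a :: real_normed_vector"
  assumes "v \<in> J" "\<And>w. w \<in> J \<Longrightarrow> F u w = H w" "(H has_vector_derivative D) (at v within J)"
  shows "D_y J f F u v = (1 / f u) *\<^sub>R D"
  unfolding D_y_def pd2_def using vderiv_eqI[OF J assms] by simp

lemmas dwedge = has_vector_derivative_wedge[OF deriv_l deriv_t]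
  has_vector_derivative_wedge[OF has_vector_derivative_const deriv_t]
  has_vector_derivative_wedge[OF deriv_l deriv_n]
  has_vector_derivative_wedge[OF has_vector_derivative_const deriv_n]
  has_vector_derivative_wedge[OF has_vector_derivative_const deriv_l]

lemma D_y_G: assumes "u \<in> I" "v \<in> J"
  shows "D_y J f G u v = (1 / f u) *\<^sub>R ((f1 u * \<kappa> v) *\<^sub>R wedge (l v) (n v)
    + (g1 u * \<kappa> v) *\<^sub>R wedge e4 (n v) - g1 u *\<^sub>R wedge e4 (l v))"
proof (rule D_y_eqI[OF assms(2)])
  show "G u w = f1 u *\<^sub>R wedge (l w) (t w) + g1 u *\<^sub>R wedge e4 (t w)" if "w \<in> J" for w
    by (rule G_eq[OF assms(1) that])
  have "((\<lambda>v. f1 u *\<^sub>R wedge (l v) (t v) + g1 u *\<^sub>R wedge e4 (t v)) has_vector_derivative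
      f1 u *\<^sub>R (wedge (l v) (\<kappa> v *\<^sub>R n v - l v) + wedge (t v) (t v))
      + g1 u *\<^sub>R (wedge e4 (\<kappa> v *\<^sub>R n v - l v) + wedge 0 (t v))) (at v within J)"
    using assms by (auto intro!: derivative_eq_intros dwedge)
  moreover have "wedge 0 (t v) = 0" by (simp add: wedge_def vec_eq_iff)
  ultimately show "((\<lambda>v. f1 u *\<^sub>R wedge (l v) (t v) + g1 u *\<^sub>R wedge e4 (t v)) has_vector_derivative
      (f1 u * \<kappa> v) *\<^sub>R wedge (l v) (n v) + (g1 u * \<kappa> v) *\<^sub>R wedge e4 (n v) - g1 u *\<^sub>R wedge e4 (l v)) (at v within J)"
    by (simp add: wedge_simps algebra_simps)
qed

lemma D_yy_G: assumes "u \<in> I" "v \<in> J"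
  shows "D_y J f (D_y J f G) u v = (1 / (f u)\<^sup>2) *\<^sub>R ((f1 u * \<kappa>' v) *\<^sub>R wedge (l v) (n v)
    + (g1 u * \<kappa>' v) *\<^sub>R wedge e4 (n v) + (f1 u * \<kappa> v) *\<^sub>R wedge (t v) (n v)
    - (f1 u * (\<kappa> v)\<^sup>2) *\<^sub>R wedge (l v) (t v) - (g1 u * (\<kappa> v)\<^sup>2 + g1 u) *\<^sub>R wedge e4 (t v))"
    (is "_ = _ *\<^sub>R ?R")
proof -
  let ?H = "\<lambda>v. (f1 u * \<kappa> v) *\<^sub>R wedge (l v) (n v)
    + (g1 u * \<kappa> v) *\<^sub>R wedge e4 (n v) - g1 u *\<^sub>R wedge e4 (l v)"
  have "(?H has_vector_derivative
      (f1 u * \<kappa> v) *\<^sub>R (wedge (l v) (- \<kappa> v *\<^sub>R t v) + wedge (t v) (n v)) + (f1 u * \<kappa>' v) *\<^sub>R wedge (l v) (n v)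
      + ((g1 u * \<kappa> v) *\<^sub>R (wedge e4 (- \<kappa> v *\<^sub>R t v) + wedge 0 (n v)) + (g1 u * \<kappa>' v) *\<^sub>R wedge e4 (n v))
      - g1 u *\<^sub>R (wedge e4 (t v) + wedge 0 (l v))) (at v within J)"
    by (intro has_vector_derivative_add has_vector_derivative_diff has_vector_derivative_scaleR
        dwedge assms(2)
        bounded_linear.has_vector_derivative[OF bounded_linear_scaleR_right]
        bounded_linear.has_vector_derivative[OF bounded_linear_mult_right]
        deriv_kappa[OF assms(2), folded has_real_derivative_iff_has_vector_derivative]
        DERIV_cmult)
  moreover have "wedge 0 (n v) = 0" "wedge 0 (l v) = 0" by (simp_all add: wedge_def vec_eq_iff)
  ultimately have "(?H has_vector_derivative ?R) (at v within J)"
    by (simp add: wedge_simps power2_eq_square algebra_simps)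
  then have "((\<lambda>v. (1 / f u) *\<^sub>R ?H v) has_vector_derivative (1 / f u) *\<^sub>R ?R) (at v within J)"
    by (rule bounded_linear.has_vector_derivative[OF bounded_linear_scaleR_right])
  then have "D_y J f (D_y J f G) u v = (1 / f u) *\<^sub>R ((1 / f u) *\<^sub>R ?R)"
    by (rule D_y_eqI[OF assms(2), of "D_y J f G", rotated]) (rule D_y_G[OF assms(1)])
  then show ?thesis by (simp add: power2_eq_square)
qed

lemma mink_frame: assumes "v \<in> J"
  shows "mink (a *\<^sub>R l v + b *\<^sub>R t v + c *\<^sub>R n v + d *\<^sub>R e4) (a' *\<^sub>R l v + b' *\<^sub>R t v + c' *\<^sub>R n v + d' *\<^sub>R e4)
    = a * a' + b * b' + c * c' - d * d'"
  using frame[OF assms] comp4[OF assms]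
  by (simp add: mink_inner inner_add_left inner_add_right e4_4)

lemma D_x_frame_x: "u \<in> I \<Longrightarrow> D_x I (frame_x I z) u v = f2 u *\<^sub>R l v + g2 u *\<^sub>R e4"
  unfolding D_x_def by (rule pd1_combination) (auto simp: frame_x_eq smooth_derivs)

lemma D_y_frame_y: "u \<in> I \<Longrightarrow> v \<in> J \<Longrightarrow>
    D_y J f (frame_y J f z) u v = (1 / f u) *\<^sub>R (\<kappa> v *\<^sub>R n v - l v)"
  by (rule D_y_eqI[OF _ frame_y_eq deriv_t])

lemma nabla_xx_eq: assumes "u \<in> I" "v \<in> J" shows "nabla_xx I J f z u v = 0"
proof -
  have "mink (D_x I (frame_x I z) u v) (frame_x I z u v) = f2 u * f1 u - g2 u * g1 u"
    using mink_frame[OF assms(2), of "f2 u" 0 0 "g2 u" "f1 u" 0 0 "g1 u"]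
    by (simp add: D_x_frame_x frame_x_eq assms)
  moreover have "mink (D_x I (frame_x I z) u v) (frame_y J f z u v) = 0"
    using mink_frame[OF assms(2), of "f2 u" 0 0 "g2 u" 0 1 0 0]
    by (simp add: D_x_frame_x frame_y_eq assms)
  ultimately show ?thesis
    using speed_diff[OF assms(1)] by (simp add: nabla_xx_def tangential_def mult.commute)
qed

lemma nabla_yy_eq: assumes "u \<in> I" "v \<in> J"
  shows "nabla_yy I J f z u v = - (f1 u / f u) *\<^sub>R frame_x I z u v"
proof -
  have *: "D_y J f (frame_y J f z) u v = (- 1 / f u) *\<^sub>R l v + 0 *\<^sub>R t v + (\<kappa> v / f u) *\<^sub>R n v + 0 *\<^sub>R e4"
    by (simp add: D_y_frame_y assms algebra_simps)
  have "mink (D_y J f (frame_y J f z) u v) (frame_x I z u v) = - (f1 u / f u)"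
    using mink_frame[OF assms(2), of "- 1 / f u" 0 "\<kappa> v / f u" 0 "f1 u" 0 0 "g1 u"]
    by (simp add: * frame_x_eq assms)
  moreover have "mink (D_y J f (frame_y J f z) u v) (frame_y J f z u v) = 0"
    using mink_frame[OF assms(2), of "- 1 / f u" 0 "\<kappa> v / f u" 0 0 1 0 0]
    by (simp add: * frame_y_eq assms)
  ultimately show ?thesis by (simp add: nabla_yy_def tangential_def)
qed

lemma mink_frame_xy: assumes "u \<in> I" "v \<in> J"
  shows "mink (frame_x I z u v) (frame_x I z u v) = 1" "mink (frame_x I z u v) (frame_y J f z u v) = 0"
  using mink_frame[OF assms(2), of "f1 u" 0 0 "g1 u" "f1 u" 0 0 "g1 u"]
    mink_frame[OF assms(2), of "f1 u" 0 0 "g1 u" 0 1 0 0] unit_speed[OF assms(1)]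
  by (simp_all add: frame_x_eq frame_y_eq assms power2_eq_square)

text \<open>The meridians are geodesics, so \<open>\<nabla>\<^sub>x x\<close> contributes nothing,
  while \<open>\<nabla>\<^sub>y y\<close> contributes a multiple of the first derivative of
  \<open>G\<close> along \<open>x\<close>, which goes into \<open>A\<close> and \<open>B\<close>.
  Everything that involves \<kappa> comes from differentiating twice along \<open>y\<close>.\<close>

lemma laplacian_G: assumes "u \<in> I" "v \<in> J"
  shows "laplacian I J f z G u v =
    (A u + (\<kappa> v)\<^sup>2 * f1 u / (f u)\<^sup>2) *\<^sub>R wedge (l v) (t v)
    + (B u + (\<kappa> v)\<^sup>2 * g1 u / (f u)\<^sup>2) *\<^sub>R wedge e4 (t v)
    - (\<kappa> v * f1 u / (f u)\<^sup>2) *\<^sub>R wedge (t v) (n v)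
    - (\<kappa>' v * f1 u / (f u)\<^sup>2) *\<^sub>R wedge (l v) (n v)
    - (\<kappa>' v * g1 u / (f u)\<^sup>2) *\<^sub>R wedge e4 (n v)"
proof -
  have x: "D_tan I J f z (nabla_xx I J f z) G u v = 0"
    by (simp add: D_tan_def nabla_xx_eq assms mink_def)
  have y: "D_tan I J f z (nabla_yy I J f z) G u v = - (f1 u / f u) *\<^sub>R (f2 u *\<^sub>R wedge (l v) (t v) + g2 u *\<^sub>R wedge e4 (t v))"
    by (simp add: D_tan_def nabla_yy_eq mink_scaleR_left mink_frame_xy D_x_G assms del: scaleR_minus_left)
  show ?thesis
    unfolding laplacian_def x y D_xx_G[OF assms] D_yy_G[OF assms] A_def B_def
    by (simp add: scaleR_add_left scaleR_add_right scaleR_diff_right scaleR_diff_left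
        add_divide_distrib power2_eq_square mult_ac)
qed

end

subsection \<open>Characterisation of pointwise 1-type Gauss maps of second kind\<close>

lemma zero_vderiv_constant:
  fixes h :: "real \<Rightarrow> 'a :: real_normed_vector"
  assumes "interval_dom S" "\<And>x. x \<in> S \<Longrightarrow> (h has_vector_derivative 0) (at x within S)"
    and "a \<in> S" "b \<in> S"
  shows "h a = h b"
  using has_vector_derivative_zero_constant[OF interval_dom_convex[OF assms(1)], of h] assms
  by metis

lemma vderiv_of_constant:
  assumes "interval_dom S" "x \<in> S" "\<And>s. s \<in> S \<Longrightarrow> h s = c"
  shows "vderiv S h x = 0"
  by (rule vderiv_eqI[OF assms]) auto

section \<open>Affine meridians\<close>

context meridian_curve
begin

definition "affine_meridian a a1 b b1 \<longleftrightarrow>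
  (\<forall>u\<in>I. f u = a * u + a1) \<and> (\<forall>u\<in>I. g u = b * u + b1) \<and> a\<^sup>2 \<ge> 1 \<and> a\<^sup>2 - b\<^sup>2 = 1"

lemma I_ne: "\<exists>u. u \<in> I"
  using I by (auto simp: interval_dom_def)

lemma affine_primitive:
  assumes "smooth_on I h" "\<And>u. u \<in> I \<Longrightarrow> vderiv I h u = c"
  shows "\<exists>d. \<forall>u\<in>I. h u = c * u + d"
proof -
  obtain u0 where u0: "u0 \<in> I" using I_ne by blast
  have "((\<lambda>u. h u - c * u) has_vector_derivative 0) (at u within I)" if "u \<in> I" for u
    unfolding has_real_derivative_iff_has_vector_derivative[symmetric]
    by (auto intro!: derivative_eq_intros dv assms that)
  then have "h u - c * u = h u0 - c * u0" if "u \<in> I" for u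
    using zero_vderiv_constant[OF I _ that u0] by blast
  then show ?thesis by (intro exI[of _ "h u0 - c * u0"]) (auto simp: algebra_simps)
qed

text \<open>Unit speed makes the square of \<open>g1\<close> constant. Either \<open>g1\<close>
  vanishes identically, or it vanishes nowhere and \<open>g1 * g2 = f1 * f2 = 0\<close> yields
  \<open>g2 = 0\<close>, which excludes a change of sign.\<close>

lemma affine_if_f1_constant:
  assumes f1: "\<And>u. u \<in> I \<Longrightarrow> f1 u = a"
  shows "\<exists>a a1 b b1. affine_meridian a a1 b b1"
proof -
  obtain u0 where u0: "u0 \<in> I" using I_ne by blast
  have f2: "f2 u = 0" if "u \<in> I" for u using vderiv_of_constant[OF I that f1] .
  have g1: "g1 u = g1 u0" if u: "u \<in> I" for u
  proof (cases "g1 u0 = 0")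
    case True
    then show ?thesis using f1_sq[OF u] f1_sq[OF u0] f1[OF u] f1[OF u0] by simp
  next
    case False
    have "g2 s = 0" if s: "s \<in> I" for s
    proof -
      have "g1 s \<noteq> 0" using f1_sq[OF s] f1_sq[OF u0] f1[OF s] f1[OF u0] False by auto
      then show ?thesis using speed_diff[OF s] f2[OF s] by simp
    qed
    then show ?thesis
      using zero_vderiv_constant[OF I _ u u0, of g1] smooth_on_has_vderiv[OF I smooth_derivs(4)] by metis
  qed
  obtain a1 b1 where ab: "\<forall>u\<in>I. f u = a * u + a1" "\<forall>u\<in>I. g u = g1 u0 * u + b1"
    using affine_primitive[OF sf f1] affine_primitive[OF sg g1] by blast
  have sq: "a\<^sup>2 - (g1 u0)\<^sup>2 = 1" using unit_speed[OF u0] f1[OF u0] by simp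
  moreover have "a\<^sup>2 \<ge> 1" using sq zero_le_power2[of "g1 u0"] by linarith
  ultimately show ?thesis unfolding affine_meridian_def using ab by blast
qed

lemma affine_if_g1_zero:
  assumes "\<And>u. u \<in> I \<Longrightarrow> g1 u = 0"
  shows "\<exists>a. \<forall>u\<in>I. f1 u = a"
proof -
  have "f2 u = 0" if "u \<in> I" for u
    using speed_diff[OF that] assms[OF that] f1_nonzero[OF that] by simp
  then have "f1 u = f1 w" if "u \<in> I" "w \<in> I" for u w
    using zero_vderiv_constant[OF I _ that, of f1] smooth_on_has_vderiv[OF I smooth_derivs(1)] by metis
  then show ?thesis by metis
qed

lemma affine_derivs:
  assumes af: "affine_meridian a a1 b b1" and u: "u \<in> I"
  shows "f1 u = a" "g1 u = b" "f2 u = 0" "g2 u = 0" "A u = 0" "B u = b / (f u)\<^sup>2"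
proof -
  have *: "f1 u = a" "g1 u = b" if "u \<in> I" for u
    using af that unfolding affine_meridian_def
    by (auto intro!: vderiv_eqI[OF I, of _ _ "\<lambda>u. _ * u + _"] derivative_eq_intros
        simp flip: has_real_derivative_iff_has_vector_derivative)
  then show "f1 u = a" "g1 u = b" using u by auto
  have z: "f2 u = 0" "g2 u = 0" if "u \<in> I" for u
    using vderiv_of_constant[OF I that *(1)] vderiv_of_constant[OF I that *(2)] by auto
  have "f3 u = 0" "g3 u = 0"
    using vderiv_of_constant[OF I u z(1)] vderiv_of_constant[OF I u z(2)] by auto
  then show "f2 u = 0" "g2 u = 0" "A u = 0" "B u = b / (f u)\<^sup>2"
    using z[OF u] *[OF u] by (auto simp: A_def B_def)
qed

text \<open>With \<open>W = f' g'' - g' f''\<close>, two linear combinations of the assumptions give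
  \<open>(f W)' = 0\<close> and \<open>- f\<^sup>2 W\<^sup>2 + k\<^sup>2 + 1 = - f' / p\<close>.\<close>

lemma affine_if_curved:
  assumes p: "p \<noteq> 0"
    and EA: "\<And>u. u \<in> I \<Longrightarrow> A u + k\<^sup>2 * f1 u / (f u)\<^sup>2 = - f1 u / ((f u)\<^sup>2 * p) * (f1 u + p)"
    and EB: "\<And>u. u \<in> I \<Longrightarrow> B u + k\<^sup>2 * g1 u / (f u)\<^sup>2 = - f1 u / ((f u)\<^sup>2 * p) * g1 u"
  shows "\<exists>a a1 b b1. affine_meridian a a1 b b1"
proof -
  \<comment> \<open>Up to sign, \<open>W\<close> is the derivative of the hyperbolic angle of the
    meridian velocity, that is, the curvature of the meridian.\<close>
  define W where "W u = f1 u * g2 u - g1 u * f2 u" for u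
  define W' where "W' u = f1 u * g3 u - g1 u * f3 u" for u
  have E1: "- (f u)\<^sup>2 * f3 u - f u * (f1 u * f2 u) + k\<^sup>2 * f1 u = - (1 / p) * (f1 u)\<^sup>2 - f1 u"
    and E2: "- (f u)\<^sup>2 * g3 u + g1 u - f u * f1 u * g2 u + k\<^sup>2 * g1 u = - (1 / p) * f1 u * g1 u"
    if u: "u \<in> I" for u
  proof -
    have clear: "(f u)\<^sup>2 * x + k\<^sup>2 * y = - (1 / p) * f1 u * w"
      if "x + k\<^sup>2 * y / (f u)\<^sup>2 = - f1 u / ((f u)\<^sup>2 * p) * w" for x y w
    proof -
      have "(f u)\<^sup>2 * x + k\<^sup>2 * y = (f u)\<^sup>2 * (x + k\<^sup>2 * y / (f u)\<^sup>2)"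
        using f_nonzero[OF u] by (simp add: distrib_left)
      also have "\<dots> = (f u)\<^sup>2 * (- f1 u / ((f u)\<^sup>2 * p) * w)" using that by simp
      also have "\<dots> = - (1 / p) * f1 u * w" using f_nonzero[OF u] by simp
      finally show ?thesis .
    qed
    have "(f u)\<^sup>2 * A u + k\<^sup>2 * f1 u = - (1 / p) * (f1 u)\<^sup>2 - f1 u"
      "(f u)\<^sup>2 * B u + k\<^sup>2 * g1 u = - (1 / p) * f1 u * g1 u"
      using clear[OF EA[OF u]] clear[OF EB[OF u]] p by (simp_all add: algebra_simps add_divide_distrib power2_eq_square)
    moreover have "(f u)\<^sup>2 * A u = f u * (- f u * f3 u - f1 u * f2 u)"
      using f_A[OF u] by (simp add: power2_eq_square)
    ultimately show "- (f u)\<^sup>2 * f3 u - f u * (f1 u * f2 u) + k\<^sup>2 * f1 u = - (1 / p) * (f1 u)\<^sup>2 - f1 u"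
      "- (f u)\<^sup>2 * g3 u + g1 u - f u * f1 u * g2 u + k\<^sup>2 * g1 u = - (1 / p) * f1 u * g1 u"
      using f_sq_B[OF u] by (simp_all add: power2_eq_square algebra_simps)
  qed
  have "((\<lambda>u. f u * W u) has_vector_derivative 0) (at u within I)" if u: "u \<in> I" for u
  proof -
    \<comment> \<open>The combination \<open>f1 * E2 - g1 * E1\<close>, in which the terms with
      \<open>k\<close> and \<open>p\<close> cancel.\<close>
    have "f u * (f u * W' u + f1 u * W u) = 0"
      using E1[OF u] E2[OF u] unfolding W_def W'_def by algebra
    then have z: "f u * W' u + f1 u * W u = 0" using f_nonzero[OF u] by simp
    have "((\<lambda>u. f u * W u) has_real_derivative f u * W' u + f1 u * W u) (at u within I)"
      unfolding W_def W'_def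
      by (auto intro!: derivative_eq_intros dv sf smooth_derivs u simp: algebra_simps)
    then show ?thesis unfolding z by (simp add: has_real_derivative_iff_has_vector_derivative)
  qed
  then have const: "f u * W u = f w * W w" if "u \<in> I" "w \<in> I" for u w
    using zero_vderiv_constant[OF I _ that] by blast
  obtain u0 where u0: "u0 \<in> I" using I_ne by blast
  define c where "c = f u0 * W u0"
  have "f1 u = - p * (k\<^sup>2 + 1 - c\<^sup>2)" if u: "u \<in> I" for u
  proof -
    have "f u * W u = c" using const[OF u u0] by (simp add: c_def)
    moreover have "(W u)\<^sup>2 = (g2 u)\<^sup>2 - (f2 u)\<^sup>2"
      unfolding W_def using speed_diff[OF u] f1_sq[OF u] by algebra
    ultimately have c: "c\<^sup>2 = (f u)\<^sup>2 * ((g2 u)\<^sup>2 - (f2 u)\<^sup>2)"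
      by (metis power_mult_distrib)
    \<comment> \<open>The combination \<open>f1 * E1 - g1 * E2\<close>, where
      \<open>f1 * f3 - g1 * g3\<close> equals the square of \<open>W\<close>. The name
      \<open>d\<close> hides the division from \<open>algebra\<close>.\<close>
    define d where "d = 1 / p"
    have "k\<^sup>2 + 1 - c\<^sup>2 = - d * f1 u"
      using E1[OF u, folded d_def] E2[OF u, folded d_def] f1_sq[OF u] speed_diff[OF u]
        speed_diff2[OF u] c by algebra
    then have "k\<^sup>2 + 1 - c\<^sup>2 = - (1 / p) * f1 u" by (simp add: d_def)
    then show ?thesis using p by (simp add: field_simps)
  qed
  then show ?thesis by (rule affine_if_f1_constant)
qed

end

section \<open>Sufficient conditions for a pointwise 1-type Gauss map\<close>

context elliptic_meridian
begin

lemma J_ne: "\<exists>v. v \<in> J"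
  using J by (auto simp: interval_dom_def)

lemma kappa_constant:
  assumes "\<And>v. v \<in> J \<Longrightarrow> \<kappa>' v = 0" "v \<in> J" "w \<in> J" shows "\<kappa> v = \<kappa> w"
  using zero_vderiv_constant[OF J _ assms(2,3), of \<kappa>] deriv_kappa assms(1) by metis

lemma kappa'_zero:
  assumes "\<And>v. v \<in> J \<Longrightarrow> \<kappa> v = k" "v \<in> J" shows "\<kappa>' v = 0"
  using vderiv_of_constant[OF J assms(2,1)] .

lemma pointwise_if_affine:
  assumes \<kappa>: "\<And>v. v \<in> J \<Longrightarrow> \<kappa> v = k" and af: "affine_meridian a a1 b b1"
  shows "pointwise_1_type_second_kind I J f z"
proof -
  obtain v0 where v0: "v0 \<in> J" using J_ne by blast
  have k: "k\<^sup>2 + 1 \<noteq> 0" by (smt (verit) zero_le_power2)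
  have a: "a \<noteq> 0" using af by (auto simp: affine_meridian_def)
  \<comment> \<open>The coefficients of \<open>e4 \<and> t\<close> suggest
    \<open>\<lambda> = (k\<^sup>2 + 1) / f\<^sup>2\<close>; those of \<open>l \<and> t\<close>,
    namely \<open>k\<^sup>2 a / f\<^sup>2 = \<lambda> (a + p)\<close>, then give this
    \<open>p\<close>.\<close>
  define p where "p = - a / (k\<^sup>2 + 1)"
  have p: "p \<noteq> 0" "p * (k\<^sup>2 + 1) = - a" using a k by (auto simp: p_def)
  \<comment> \<open>This is \<open>p\<close> times \<open>t \<and> t'\<close> with
    \<open>t' = k n - l\<close>. For constant curvature \<open>t''\<close> is a multiple of
    \<open>t\<close>, so the bivector is constant.\<close>
  define C where "C v = p *\<^sub>R wedge (l v) (t v) + (k * p) *\<^sub>R wedge (t v) (n v)" for v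
  have "(C has_vector_derivative 0) (at v within J)" if v: "v \<in> J" for v
  proof -
    have "(C has_vector_derivative
        p *\<^sub>R (wedge (l v) (\<kappa> v *\<^sub>R n v - l v) + wedge (t v) (t v))
        + (k * p) *\<^sub>R (wedge (t v) (- \<kappa> v *\<^sub>R t v) + wedge (\<kappa> v *\<^sub>R n v - l v) (n v))) (at v within J)"
      unfolding C_def[abs_def]
      by (intro has_vector_derivative_add dwedge v has_vector_derivative_wedge[OF deriv_t deriv_n]
          bounded_linear.has_vector_derivative[OF bounded_linear_scaleR_right])
    then show ?thesis using \<kappa>[OF v] by (simp add: wedge_simps mult.commute)
  qed
  then have C: "C v = C v0" if "v \<in> J" for v using zero_vderiv_constant[OF J _ that v0] by blast
  define L where "L u = (k\<^sup>2 + 1) / (f u)\<^sup>2" for u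
  have "smooth_on I L" unfolding L_def[abs_def]
    by (intro smooth_on_divide smooth_on_const smooth_on_power sf I) (simp add: f_nonzero)
  then have 1: "smooth_on2 I J (\<lambda>u v. L u)" by (rule smooth_on2_fst[OF I])
  have "l v0 \<bullet> (C v0 *v t v0) = p"
    unfolding C_def using frame[OF v0]
    by (simp add: matrix_vector_mult_add_rdistrib scaleR_matrix_vector_assoc[symmetric]
        inner_add_right inner_wedge_mult)
  then have 2: "C v0 \<noteq> 0" using p(1) by auto
  have 3: "C v0 \<in> bivectors" unfolding C_def by (intro bivectors_add bivectors_scaleR wedge_bivector)
  have "laplacian I J f z G u v = L u *\<^sub>R (G u v + C v0)" if uv: "u \<in> I" "v \<in> J" for u v
  proof -
    have e: "\<kappa> v = k" "\<kappa>' v = 0" using \<kappa> kappa'_zero[OF \<kappa>] uv by auto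
    have i: "L u * (a + p) = k\<^sup>2 * a / (f u)\<^sup>2" "L u * (k * p) = - (k * a / (f u)\<^sup>2)"
      "L u * b = b / (f u)\<^sup>2 + k\<^sup>2 * b / (f u)\<^sup>2"
    proof -
      have "(k\<^sup>2 + 1) * (a + p) = k\<^sup>2 * a" using p(2) by (simp add: algebra_simps)
      then show "L u * (a + p) = k\<^sup>2 * a / (f u)\<^sup>2" by (simp add: L_def)
      have "(k\<^sup>2 + 1) * (k * p) = - (k * a)" using p(2) by algebra
      then show "L u * (k * p) = - (k * a / (f u)\<^sup>2)" by (simp add: L_def)
      show "L u * b = b / (f u)\<^sup>2 + k\<^sup>2 * b / (f u)\<^sup>2"
        by (simp add: L_def add_divide_distrib[symmetric] algebra_simps)
    qed
    have Cv: "C v0 = p *\<^sub>R wedge (l v) (t v) + (k * p) *\<^sub>R wedge (t v) (n v)"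
      using C[OF uv(2), symmetric] by (simp only: C_def)
    have "L u *\<^sub>R (G u v + C v0) = (L u * (a + p)) *\<^sub>R wedge (l v) (t v) + (L u * b) *\<^sub>R wedge e4 (t v)
        + (L u * (k * p)) *\<^sub>R wedge (t v) (n v)"
      unfolding Cv G_eq[OF uv] affine_derivs[OF af uv(1)]
      by (simp add: algebra_simps)
    then show ?thesis
      unfolding i laplacian_G[OF uv] affine_derivs[OF af uv(1)] e by simp
  qed
  moreover have "L u \<noteq> 0" if "u \<in> I" for u using k f_nonzero[OF that] by (simp add: L_def)
  ultimately show ?thesis unfolding pointwise_1_type_second_kind_def using 1 2 3 by blast
qed

text \<open>For a great circle \<open>l \<and> t\<close> is the constant bivector of its plane, so
  only the two scalar equations solved by \<open>multiplier_exists\<close> remain.\<close>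

lemma pointwise_if_ode:
  assumes \<kappa>: "\<And>v. v \<in> J \<Longrightarrow> \<kappa> v = 0" and ode: "meridian_ode I f"
  shows "pointwise_1_type_second_kind I J f z"
proof -
  interpret meridian_curve_ode I f g by unfold_locales (rule ode)
  obtain p L where p: "p \<noteq> 0" and L: "smooth_on I L"
    "\<And>u. u \<in> I \<Longrightarrow> L u \<noteq> 0 \<and> A u = L u * (f1 u + p) \<and> B u = L u * g1 u"
    using multiplier_exists by blast
  obtain v0 where v0: "v0 \<in> J" using J_ne by blast
  define C where "C v = p *\<^sub>R wedge (l v) (t v)" for v
  have "(C has_vector_derivative 0) (at v within J)" if v: "v \<in> J" for v
  proof -
    have "(C has_vector_derivative
        p *\<^sub>R (wedge (l v) (\<kappa> v *\<^sub>R n v - l v) + wedge (t v) (t v))) (at v within J)"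
      unfolding C_def[abs_def]
      by (intro dwedge v bounded_linear.has_vector_derivative[OF bounded_linear_scaleR_right])
    then show ?thesis using \<kappa>[OF v] by (simp add: wedge_simps)
  qed
  then have C: "C v = C v0" if "v \<in> J" for v using zero_vderiv_constant[OF J _ that v0] by blast
  have "l v0 \<bullet> (C v0 *v t v0) = p"
    unfolding C_def using frame[OF v0]
    by (simp add: scaleR_matrix_vector_assoc[symmetric] inner_wedge_mult)
  then have 2: "C v0 \<noteq> 0" using p by auto
  have 3: "C v0 \<in> bivectors" unfolding C_def by (intro bivectors_scaleR wedge_bivector)
  have "laplacian I J f z G u v = L u *\<^sub>R (G u v + C v0)" if uv: "u \<in> I" "v \<in> J" for u v
  proof -
    have e: "\<kappa> v = 0" "\<kappa>' v = 0" using \<kappa> kappa'_zero[OF \<kappa>] uv by auto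
    have AB: "A u = L u * (f1 u + p)" "B u = L u * g1 u" using L(2)[OF uv(1)] by auto
    have Cv: "C v0 = p *\<^sub>R wedge (l v) (t v)" using C[OF uv(2), symmetric] by (simp only: C_def)
    show ?thesis
      unfolding laplacian_G[OF uv] e Cv G_eq[OF uv] AB
      by (simp add: algebra_simps)
  qed
  then show ?thesis unfolding pointwise_1_type_second_kind_def
    using smooth_on2_fst[OF I L(1), of J] L(2) 2 3 by blast
qed

section \<open>Necessary conditions for a pointwise 1-type Gauss map\<close>

lemma pairing_derivative:
  fixes C :: "real ^ 4 ^ 4" and h k :: "real \<Rightarrow> real ^ 4"
  assumes "(h has_vector_derivative h') (at v within J)" "(k has_vector_derivative k') (at v within J)"
  shows "((\<lambda>w. h w \<bullet> (C *v k w)) has_vector_derivative h v \<bullet> (C *v k') + h' \<bullet> (C *v k v)) (at v within J)"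
  by (rule has_vector_derivative_inner[OF assms(1)
        bounded_linear.has_vector_derivative[OF matrix_vector_mul_bounded_linear assms(2)]])

lemma affine_or_ode_if_pointwise:
  assumes "pointwise_1_type_second_kind I J f z"
  shows "(\<exists>k a a1 b b1. (\<forall>v\<in>J. \<kappa> v = k) \<and> affine_meridian a a1 b b1) \<or>
    (\<forall>v\<in>J. \<kappa> v = 0) \<and> meridian_ode I f"
proof -
  obtain lam C where lam: "smooth_on2 I J lam" "\<And>u v. u \<in> I \<Longrightarrow> v \<in> J \<Longrightarrow> lam u v \<noteq> 0"
    and C: "C \<in> bivectors" "C \<noteq> 0"
    and eq: "\<And>u v. u \<in> I \<Longrightarrow> v \<in> J \<Longrightarrow> laplacian I J f z G u v = lam u v *\<^sub>R (G u v + C)"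
    using assms unfolding pointwise_1_type_second_kind_def by blast
  \<comment> \<open>The coefficients of \<open>C\<close> in the moving frame: \<open>p\<close>,
    \<open>q\<close>, \<open>r\<close> for pairs inside the Euclidean part, capitals for pairs with
    \<open>e4\<close>.\<close>
  define c where "c x y = x \<bullet> (C *v y)" for x y
  define p where "p v = c (l v) (t v)" for v
  define q where "q v = c (t v) (n v)" for v
  define r where "r v = c (l v) (n v)" for v
  define P where "P v = c e4 (t v)" for v
  define R where "R v = c e4 (n v)" for v
  define S where "S v = c e4 (l v)" for v
  have skew: "c x x = 0" "c y x = - c x y" for x y
    using bivector_swap[OF C(1), of x x] bivector_swap[OF C(1), of y x] by (auto simp: c_def)
  have cl: "c x (y + y') = c x y + c x y'" "c x (y - y') = c x y - c x y'" "c x (s *\<^sub>R y) = s * c x y"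
    "c x (- y) = - c x y"
    "c (y + y') x = c y x + c y' x" "c (y - y') x = c y x - c y' x" "c (s *\<^sub>R y) x = s * c y x" "c 0 x = 0"
    for x y y' s
    by (simp_all add: c_def matrix_vector_right_distrib inner_add_right inner_add_left inner_diff_left
        inner_diff_right matrix_vector_mult_diff_distrib scaleR_matrix_vector_assoc[symmetric]
        matrix_vector_mult_scaleR linear_neg[OF matrix_vector_mul_linear])
  note dc = pairing_derivative[of _ _ _ _ _ C, folded c_def]
  have dp: "(p has_vector_derivative \<kappa> v * r v) (at v within J)" if v: "v \<in> J" for v
    using dc[OF deriv_l[OF v] deriv_t[OF v]] by (simp add: p_def[abs_def] r_def cl skew(1))
  have dq: "(q has_vector_derivative - r v) (at v within J)" if v: "v \<in> J" for v
    using dc[OF deriv_t[OF v] deriv_n[OF v]] by (simp add: q_def[abs_def] r_def cl skew(1))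
  have dr: "(r has_vector_derivative q v - \<kappa> v * p v) (at v within J)" if v: "v \<in> J" for v
    using dc[OF deriv_l[OF v] deriv_n[OF v]] by (simp add: r_def[abs_def] p_def q_def cl skew(1))
  have dS: "(S has_vector_derivative P v) (at v within J)" if v: "v \<in> J" for v
    using dc[OF has_vector_derivative_const[of e4] deriv_l[OF v]] by (simp add: S_def[abs_def] P_def cl)
  have dP: "(P has_vector_derivative \<kappa> v * R v - S v) (at v within J)" if v: "v \<in> J" for v
    using dc[OF has_vector_derivative_const[of e4] deriv_t[OF v]]
    by (simp add: P_def[abs_def] R_def S_def cl)
  have dR: "(R has_vector_derivative - \<kappa> v * P v) (at v within J)" if v: "v \<in> J" for v
    using dc[OF has_vector_derivative_const[of e4] deriv_n[OF v]] by (simp add: R_def[abs_def] P_def cl)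
  have comp: "A u + (\<kappa> v)\<^sup>2 * f1 u / (f u)\<^sup>2 = lam u v * (f1 u + p v)"
    "B u + (\<kappa> v)\<^sup>2 * g1 u / (f u)\<^sup>2 = lam u v * (g1 u + P v)"
    "- (\<kappa> v * f1 u / (f u)\<^sup>2) = lam u v * q v"
    "- (\<kappa>' v * f1 u / (f u)\<^sup>2) = lam u v * r v"
    "- (\<kappa>' v * g1 u / (f u)\<^sup>2) = lam u v * R v"
    "lam u v * S v = 0" if uv: "u \<in> I" "v \<in> J" for u v
  proof -
    have *: "x \<bullet> (laplacian I J f z G u v *v y) = lam u v * (x \<bullet> (G u v *v y) + c x y)" for x y
      unfolding eq[OF uv] c_def
      by (simp add: scaleR_matrix_vector_assoc[symmetric] matrix_vector_mult_add_rdistrib inner_add_right)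
    note simps = laplacian_G[OF uv] G_eq[OF uv] frame[OF uv(2)] matrix_vector_mult_add_rdistrib
      matrix_vector_mult_diff_rdistrib scaleR_matrix_vector_assoc[symmetric] inner_add_right
      inner_diff_right inner_wedge_mult
    show "A u + (\<kappa> v)\<^sup>2 * f1 u / (f u)\<^sup>2 = lam u v * (f1 u + p v)"
      using *[of "l v" "t v"] by (simp add: simps p_def)
    show "B u + (\<kappa> v)\<^sup>2 * g1 u / (f u)\<^sup>2 = lam u v * (g1 u + P v)"
      using *[of e4 "t v"] by (simp add: simps P_def)
    show "- (\<kappa> v * f1 u / (f u)\<^sup>2) = lam u v * q v"
      using *[of "t v" "n v"] by (simp add: simps q_def)
    show "- (\<kappa>' v * f1 u / (f u)\<^sup>2) = lam u v * r v"
      using *[of "l v" "n v"] by (simp add: simps r_def)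
    show "- (\<kappa>' v * g1 u / (f u)\<^sup>2) = lam u v * R v"
      using *[of e4 "n v"] by (simp add: simps R_def)
    show "lam u v * S v = 0"
      using *[of e4 "l v"] by (simp add: simps S_def)
  qed
  obtain u0 where u0: "u0 \<in> I" using I_ne by blast
  \<comment> \<open>Neither \<open>G\<close> nor its Laplacian has an \<open>e4 \<and> l\<close>
    term, hence \<open>S = 0\<close>. Then \<open>S' = P\<close> and
    \<open>P' = \<kappa> R - S\<close> give \<open>P = 0\<close> and \<open>\<kappa> R = 0\<close>,
    and \<open>R' = - \<kappa> P\<close> makes \<open>R\<close> constant.\<close>
  have S0: "S v = 0" if "v \<in> J" for v using comp(6)[OF u0 that] lam(2)[OF u0 that] by simp
  have P0: "P v = 0" if v: "v \<in> J" for v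
    using vderiv_of_constant[OF J v S0] vderiv_eqI[OF J v refl dS[OF v]] by simp
  have R0: "\<kappa> v * R v = 0" if v: "v \<in> J" for v
    using vderiv_of_constant[OF J v P0] vderiv_eqI[OF J v refl dP[OF v]] S0[OF v] by simp
  have Rc: "R v = R w" if "v \<in> J" "w \<in> J" for v w
    using zero_vderiv_constant[OF J _ that, of R] dR P0 by (metis mult_zero_right)
  show ?thesis
  proof (cases "\<forall>v\<in>J. \<kappa> v = 0")
    case True
    then have k0: "\<And>v. v \<in> J \<Longrightarrow> \<kappa> v = 0" by blast
    obtain v0 where v0: "v0 \<in> J" using J_ne by blast
    have k': "\<kappa>' v0 = 0" using kappa'_zero[OF k0 v0] .
    have z: "q v0 = 0" "r v0 = 0" "R v0 = 0"
      using comp(3-5)[OF u0 v0] k' k0[OF v0] lam(2)[OF u0 v0] by auto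
    \<comment> \<open>\<open>C \<noteq> 0\<close> enters here: the other five coefficients vanish at
      \<open>v0\<close>, so \<open>p v0 = 0\<close> would annihilate \<open>C\<close> on a whole
      basis.\<close>
    have p0: "p v0 \<noteq> 0"
    proof
      assume "p v0 = 0"
      then have up: "c (l v0) (t v0) = 0" "c (t v0) (n v0) = 0" "c (l v0) (n v0) = 0"
        "c e4 (t v0) = 0" "c e4 (n v0) = 0" "c e4 (l v0) = 0"
        using z S0[OF v0] P0[OF v0] by (simp_all add: p_def q_def r_def P_def R_def S_def)
      have "c (t v0) (l v0) = 0" "c (n v0) (t v0) = 0" "c (n v0) (l v0) = 0"
        "c (t v0) e4 = 0" "c (n v0) e4 = 0" "c (l v0) e4 = 0"
        unfolding skew(2)[of "t v0" "l v0"] skew(2)[of "n v0"] skew(2)[of _ e4] up by simp_all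
      with up have pairs: "c x y = 0" if "x \<in> {l v0, t v0, n v0, e4}" "y \<in> {l v0, t v0, n v0, e4}" for x y
        using that skew(1) by auto
      have "C *v y = 0" if "y \<in> {l v0, t v0, n v0, e4}" for y
        using frame_expand[OF v0, of "C *v y"] pairs[OF _ that]
        by (simp add: c_def inner_commute[of "C *v y"])
      then have "C *v x = 0" for x
        by (subst frame_expand[OF v0, of x])
          (simp add: matrix_vector_right_distrib matrix_vector_mult_scaleR)
      then have "C = 0" by (simp add: matrix_eq)
      then show False using C(2) by simp
    qed
    show ?thesis
    proof (cases "\<forall>u\<in>I. g1 u = 0")
      \<comment> \<open>A great circle with constant \<open>g\<close> gives a piece of a plane,
        which falls under the affine case with \<open>k = 0\<close>.\<close>
      case True
      then show ?thesis using affine_if_g1_zero affine_if_f1_constant k0 by metis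
    next
      case False
      then obtain u1 where u1: "u1 \<in> I" "g1 u1 \<noteq> 0" by blast
      have "meridian_ode I f"
      proof (rule meridian_ode_if_multiplier[where L = "\<lambda>u. lam u v0", OF p0 _ _ _ _ u1])
        show "continuous_on I (\<lambda>u. lam u v0)" using smooth_on2_continuous_fst[OF lam(1) v0] .
        fix u assume u: "u \<in> I"
        show "lam u v0 \<noteq> 0" using lam(2)[OF u v0] .
        show "A u = lam u v0 * (f1 u + p v0)" "B u = lam u v0 * g1 u"
          using comp(1,2)[OF u v0] k0[OF v0] P0[OF v0] by auto
      qed
      then show ?thesis using k0 by blast
    qed
  next
    case False
    then obtain v0 where v0: "v0 \<in> J" "\<kappa> v0 \<noteq> 0" by blast
    have RR: "R v = 0" if "v \<in> J" for v using R0[OF v0(1)] v0 Rc[OF that v0(1)] by simp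
    have kg: "\<kappa>' v * g1 u = 0" if "u \<in> I" "v \<in> J" for u v
      using comp(5)[OF that] RR[OF that(2)] f_nonzero[OF that(1)] by auto
    have r0: "r v = 0" if "v \<in> J" "\<kappa>' v = 0" for v
      using comp(4)[OF u0 that(1)] that(2) lam(2)[OF u0 that(1)] by simp
    show ?thesis
    proof (cases "\<forall>u\<in>I. g1 u = 0")
      \<comment> \<open>Here \<open>kg\<close> says nothing, and constancy of \<kappa> is drawn from
        the slice \<open>u = u0\<close>. Eliminating \<lambda> makes \<open>\<kappa> q\<close>
        constant and non-zero, so \<kappa> has no zero, and then \<open>p\<close> is constant. Now
        \<open>p' = \<kappa> r\<close> forces \<open>r = 0\<close>, and comparing
        \<open>l \<and> n\<close> gives \<open>\<kappa>' = 0\<close>.\<close>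
      case True
      then obtain a where a: "\<And>u. u \<in> I \<Longrightarrow> f1 u = a" using affine_if_g1_zero by metis
      have f2: "f2 u = 0" if "u \<in> I" for u using vderiv_of_constant[OF I that a] .
      have "A u0 = 0" using vderiv_of_constant[OF I u0 f2] f2[OF u0] by (simp add: A_def)
      have an: "a \<noteq> 0" using f1_nonzero[OF u0] a[OF u0] by simp
      define \<mu> where "\<mu> v = lam u0 v * (f u0)\<^sup>2" for v
      have \<mu>: "\<mu> v \<noteq> 0" if "v \<in> J" for v using lam(2)[OF u0 that] f_nonzero[OF u0] by (simp add: \<mu>_def)
      have e: "(\<kappa> v)\<^sup>2 * a = \<mu> v * (a + p v)" "- (\<kappa> v * a) = \<mu> v * q v" "- (\<kappa>' v * a) = \<mu> v * r v"
        if v: "v \<in> J" for v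
        using comp(1,3,4)[OF u0 v] a[OF u0] \<open>A u0 = 0\<close> f_nonzero[OF u0]
        by (simp_all add: \<mu>_def field_simps)
      have kr: "\<kappa>' v * q v = \<kappa> v * r v" if v: "v \<in> J" for v
      proof -
        have "a * (\<kappa>' v * q v) = a * (\<kappa> v * r v)" using e(2,3)[OF v] by algebra
        then show ?thesis using an by simp
      qed
      have "((\<lambda>v. \<kappa> v * q v) has_vector_derivative \<kappa> v * - r v + \<kappa>' v * q v) (at v within J)"
        if v: "v \<in> J" for v
        by (rule has_vector_derivative_mult[OF deriv_kappa[OF v] dq[OF v]])
      then have "((\<lambda>v. \<kappa> v * q v) has_vector_derivative 0) (at v within J)" if v: "v \<in> J" for v
        using kr[OF v] v by (metis add.commute mult_minus_right add.right_inverse)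
      then have kq: "\<kappa> v * q v = \<kappa> v0 * q v0" if "v \<in> J" for v
        using zero_vderiv_constant[OF J _ that v0(1)] by blast
      have "q v0 \<noteq> 0" using e(2)[OF v0(1)] v0(2) an by auto
      then have kn: "\<kappa> v \<noteq> 0" if "v \<in> J" for v using kq[OF that] v0(2) by auto
      have pc: "p v = - (\<kappa> v0 * q v0) - a" if v: "v \<in> J" for v
      proof -
        have "\<mu> v * (a + p v + \<kappa> v * q v) = 0" using e(1,2)[OF v] by algebra
        then have "a + p v + \<kappa> v0 * q v0 = 0" using \<mu>[OF v] kq[OF v] by simp
        then show ?thesis by linarith
      qed
      have "\<kappa>' v = 0" if v: "v \<in> J" for v
      proof -
        have "\<kappa> v * r v = 0"
          using vderiv_of_constant[OF J v pc] vderiv_eqI[OF J v refl dp[OF v]] by simp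
        then show ?thesis using kn[OF v] e(3)[OF v] an by simp
      qed
      then show ?thesis using kappa_constant v0(1) affine_if_f1_constant[OF a] by metis
    next
      case False
      then obtain u1 where u1: "u1 \<in> I" "g1 u1 \<noteq> 0" by blast
      have k': "\<kappa>' v = 0" if "v \<in> J" for v using kg[OF u1(1) that] u1(2) by simp
      then have k: "\<kappa> v = \<kappa> v0" if "v \<in> J" for v using kappa_constant v0(1) that by blast
      have rz: "r v = 0" if "v \<in> J" for v using r0 k' that by blast
      \<comment> \<open>Since \<open>r\<close> vanishes identically, so does
        \<open>r' = q - \<kappa> p\<close>. Inserted into the comparison of
        \<open>t \<and> n\<close>, this determines \<lambda> as a function of
        \<open>u\<close>.\<close>
      have qk: "q v0 = \<kappa> v0 * p v0"
        using vderiv_of_constant[OF J v0(1) rz] vderiv_eqI[OF J v0(1) refl dr[OF v0(1)]] by simp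
      have lp: "lam u v0 * p v0 = - f1 u / (f u)\<^sup>2" if u: "u \<in> I" for u
      proof -
        have "\<kappa> v0 * (lam u v0 * p v0) = \<kappa> v0 * (- f1 u / (f u)\<^sup>2)"
          using comp(3)[OF u v0(1)] qk by (simp add: mult_ac)
        then show ?thesis by (simp only: mult_left_cancel[OF v0(2)])
      qed
      have p0: "p v0 \<noteq> 0" using lp[OF u0] f1_nonzero[OF u0] f_nonzero[OF u0] by auto
      have l': "lam u v0 = - f1 u / ((f u)\<^sup>2 * p v0)" if u: "u \<in> I" for u
        using lp[OF u] p0 f_nonzero[OF u] by (simp add: field_simps)
      have "\<exists>a a1 b b1. affine_meridian a a1 b b1"
      proof (rule affine_if_curved[OF p0, of "\<kappa> v0"])
        fix u assume u: "u \<in> I"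
        show "A u + (\<kappa> v0)\<^sup>2 * f1 u / (f u)\<^sup>2 = - f1 u / ((f u)\<^sup>2 * p v0) * (f1 u + p v0)"
          "B u + (\<kappa> v0)\<^sup>2 * g1 u / (f u)\<^sup>2 = - f1 u / ((f u)\<^sup>2 * p v0) * g1 u"
          using comp(1,2)[OF u v0(1)] P0[OF v0(1)] l'[OF u] by auto
      qed
      then show ?thesis using k by blast
    qed
  qed
qed

end

subsection \<open>Geometry of the affine case\<close>

definition hyperplane :: "real ^ 4 \<Rightarrow> real \<Rightarrow> (real ^ 4) set" where
  "hyperplane N c = {w. mink w N = c}"

lemma hyperplane_affine:
  assumes "mink N N \<noteq> 0"
  shows "affine (hyperplane N c)" "aff_dim (hyperplane N c) = 3"
proof -
  \<comment> \<open>Reversing the sign of the fourth component turns the Minkowski normal into a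
    Euclidean one.\<close>
  define N' where "N' = N - (2 * N $ 4) *\<^sub>R e4"
  have "mink w N = N' \<bullet> w" for w
    unfolding N'_def mink_inner inner_diff_left inner_scaleR_left e4_inner inner_commute[of N w]
    by simp
  then have "hyperplane N c = {w. N' \<bullet> w = c}" by (simp add: hyperplane_def)
  moreover have "N' \<noteq> 0"
  proof
    assume "N' = 0"
    then have "N' \<bullet> N = 0" by simp
    then show False using assms unfolding N'_def mink_inner by (simp add: inner_diff_left e4_inner)
  qed
  ultimately show "affine (hyperplane N c)" "aff_dim (hyperplane N c) = 3"
    by (simp_all add: affine_hyperplane)
qed

lemma mink_diff_left: "mink (p - q) w = mink p w - mink q w"
  by (simp add: mink_def algebra_simps)

lemma mink_add_left: "mink (p + q) w = mink p w + mink q w"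
  by (simp add: mink_def algebra_simps)

lemma directions_hyperplane:
  assumes "w \<in> hyperplane N c"
  shows "directions (hyperplane N c) = {d. mink d N = 0}"
proof (intro equalityI subsetI)
  fix d assume "d \<in> {d. mink d N = 0}"
  then have "w + d \<in> hyperplane N c" "d = (w + d) - w"
    using assms by (auto simp: hyperplane_def mink_add_left)
  then show "d \<in> directions (hyperplane N c)" unfolding directions_def using assms by blast
qed (auto simp: directions_def hyperplane_def mink_diff_left)

text \<open>If \<open>d\<close> were not spacelike, Cauchy-Schwarz for the spatial parts would bound
  the square of \<open>d $ 4 * N $ 4\<close> by \<open>(d $ 4)\<^sup>2 * M\<close>, while
  \<open>M < (N $ 4)\<^sup>2\<close>. This forces \<open>d $ 4 = 0\<close> and then
  \<open>d = 0\<close>.\<close>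

lemma spacelike_orthogonal_to_timelike:
  assumes N: "mink N N < 0" and d: "mink d N = 0" "d \<noteq> 0"
  shows "mink d d > 0"
proof (rule ccontr)
  define D where "D = (d $ 1)\<^sup>2 + (d $ 2)\<^sup>2 + (d $ 3)\<^sup>2"
  define M where "M = (N $ 1)\<^sup>2 + (N $ 2)\<^sup>2 + (N $ 3)\<^sup>2"
  assume "\<not> mink d d > 0"
  then have le: "D \<le> (d $ 4)\<^sup>2" by (simp add: mink_def D_def power2_eq_square)
  have lt: "M < (N $ 4)\<^sup>2" using N by (simp add: mink_def M_def power2_eq_square)
  have s: "d $ 4 * N $ 4 = d $ 1 * N $ 1 + d $ 2 * N $ 2 + d $ 3 * N $ 3"
    using d(1) by (simp add: mink_def)
  have "D * M - (d $ 1 * N $ 1 + d $ 2 * N $ 2 + d $ 3 * N $ 3)\<^sup>2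
      = (d $ 1 * N $ 2 - d $ 2 * N $ 1)\<^sup>2 + (d $ 1 * N $ 3 - d $ 3 * N $ 1)\<^sup>2 + (d $ 2 * N $ 3 - d $ 3 * N $ 2)\<^sup>2"
    by (simp add: D_def M_def power2_eq_square algebra_simps)
  then have "(d $ 4 * N $ 4)\<^sup>2 \<le> D * M" unfolding s
    by (smt (verit) zero_le_power2)
  also have "\<dots> \<le> (d $ 4)\<^sup>2 * M" using le by (intro mult_right_mono) (auto simp: M_def)
  finally have "(d $ 4)\<^sup>2 * (N $ 4)\<^sup>2 \<le> (d $ 4)\<^sup>2 * M" by (simp add: power_mult_distrib)
  then have z: "d $ 4 = 0" using lt by (auto simp: mult_le_cancel_left)
  then have "(d $ 1)\<^sup>2 + (d $ 2)\<^sup>2 + (d $ 3)\<^sup>2 \<le> 0" using le by (simp add: D_def)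
  then have "d $ 1 = 0" "d $ 2 = 0" "d $ 3 = 0"
    by (smt (verit) zero_le_power2 power2_less_eq_zero_iff)+
  then show False using z d(2) by (simp add: vec_eq_iff forall_4)
qed

lemma hyperplane_E3_timelike:
  assumes "mink N N < 0" "w \<in> hyperplane N c"
  shows "hyperplane_E3 (hyperplane N c)"
  unfolding hyperplane_E3_def directions_hyperplane[OF assms(2)]
  using hyperplane_affine[of N c] spacelike_orthogonal_to_timelike[OF assms(1)] assms(1) by auto

lemma span_pair_scale:
  fixes x y :: "'a :: real_vector"
  assumes "c \<noteq> 0" shows "span {x, c *\<^sub>R y} = span {x, y}"
proof -
  have "y = (1 / c) *\<^sub>R (c *\<^sub>R y)" using assms by simp
  then have "y \<in> span {x, c *\<^sub>R y}" by (metis insertI1 insert_commute span_base span_scale)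
  moreover have "c *\<^sub>R y \<in> span {x, y}" by (simp add: span_base span_scale)
  ultimately show ?thesis unfolding span_eq by (auto intro: span_base)
qed

section \<open>Ruled surfaces over affine meridians and their normal vectors\<close>

context elliptic_meridian
begin

context
  fixes k a a1 b b1 :: real
  assumes \<kappa>: "\<And>v. v \<in> J \<Longrightarrow> \<kappa> v = k" and af: "affine_meridian a a1 b b1"
begin

lemma a_sq: "a\<^sup>2 = 1 + b\<^sup>2" and a_nz: "a \<noteq> 0"
  using af by (auto simp: affine_meridian_def)

lemma f_g_affine: "u \<in> I \<Longrightarrow> f u = a * u + a1" "u \<in> I \<Longrightarrow> g u = b * u + b1"
  using af by (auto simp: affine_meridian_def)

lemma affine_developable: "developable_ruled I J z"
  unfolding developable_ruled_def
proof (intro conjI ballI)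
  fix v assume v: "v \<in> J"
  let ?p = "a1 *\<^sub>R l v + b1 *\<^sub>R e4" and ?w = "a *\<^sub>R l v + b *\<^sub>R e4"
  have "?w \<bullet> l v = a" using frame[OF v] by (simp add: inner_add_left)
  then have "?w \<noteq> 0" using a_nz by auto
  moreover have "z u v = ?p + u *\<^sub>R ?w" if "u \<in> I" for u
    by (simp add: meridian_surface_def f_g_affine that algebra_simps)
  ultimately show "\<exists>p w. w \<noteq> 0 \<and> (\<forall>u\<in>I. \<exists>s. z u v = p + s *\<^sub>R w)" by blast
  fix u1 u2 assume u: "u1 \<in> I" "u2 \<in> I"
  have "tangent_plane I J z u v = span {?w, t v}" if "u \<in> I" for u
    using frame_x_eq[OF that, of v] span_pair_scale[OF f_nonzero[OF that]] affine_derivs[OF af that]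
    by (simp add: tangent_plane_def frame_x_def pd2_z[OF v])
  then show "tangent_plane I J z u1 v = tangent_plane I J z u2 v" using u by simp
qed

lemma affine_mean_curvature:
  assumes uv: "u \<in> I" "v \<in> J"
  shows "mean_curvature I J f z u v =
    (b\<^sup>2 / (2 * f u)) *\<^sub>R l v + 0 *\<^sub>R t v + (k / (2 * f u)) *\<^sub>R n v + (a * b / (2 * f u)) *\<^sub>R e4"
proof -
  have x: "sigma_xx I J f z u v = 0"
    using affine_derivs[OF af uv(1)] by (simp add: sigma_xx_def D_x_frame_x nabla_xx_eq uv)
  have "sigma_yy I J f z u v = (1 / f u) *\<^sub>R (k *\<^sub>R n v - l v) + (a / f u) *\<^sub>R (a *\<^sub>R l v + b *\<^sub>R e4)"
    using affine_derivs[OF af uv(1)] \<kappa>[OF uv(2)]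
    by (simp add: sigma_yy_def D_y_frame_y nabla_yy_eq frame_x_eq uv)
  also have "\<dots> = ((a\<^sup>2 - 1) / f u) *\<^sub>R l v + (k / f u) *\<^sub>R n v + (a * b / f u) *\<^sub>R e4"
    by (simp add: algebra_simps diff_divide_distrib power2_eq_square)
  finally show ?thesis unfolding mean_curvature_def x by (simp add: a_sq algebra_simps)
qed

text \<open>The vector \<open>2 f H = b\<^sup>2 l + k n + a b e4\<close> has square \<open>b\<^sup>2
  b\<^sup>2 + k\<^sup>2 - a\<^sup>2 b\<^sup>2 = k\<^sup>2 - b\<^sup>2\<close>. The condition
  \<open>b \<noteq> 0\<close> excludes the plane, where \<open>H = 0\<close>.\<close>

lemma affine_marginally_trapped:
  assumes "k\<^sup>2 = b\<^sup>2" "b \<noteq> 0"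
  shows "marginally_trapped I J f z"
  unfolding marginally_trapped_def
proof (intro ballI conjI)
  fix u v assume uv: "u \<in> I" "v \<in> J"
  note H = affine_mean_curvature[OF uv]
  have "mean_curvature I J f z u v \<bullet> n v = k / (2 * f u)"
    unfolding H using frame[OF uv(2)] by (simp add: inner_add_left)
  moreover have "k \<noteq> 0" using assms by auto
  ultimately show "mean_curvature I J f z u v \<noteq> 0" using f_nonzero[OF uv(1)] by auto
  have "b\<^sup>2 * b\<^sup>2 + k\<^sup>2 - (a * b)\<^sup>2 = 0" using a_sq assms(1) by algebra
  then show "mink (mean_curvature I J f z u v) (mean_curvature I J f z u v) = 0"
    unfolding H mink_frame[OF uv(2)] using f_nonzero[OF uv(1)]
    by (simp add: power2_eq_square field_simps)
qed

text \<open>The normal plane of the surface is spanned by \<open>n\<close> and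
  \<open>b l + a e4\<close>. The weights \<open>b\<close> and \<open>k\<close> are chosen so that
  the derivative \<open>b k t - b \<kappa> t\<close> vanishes; the sign of the square of this vector
  decides the type of the hyperplane.\<close>

definition "normal_vector v = (b * k) *\<^sub>R l v + 0 *\<^sub>R t v + b *\<^sub>R n v + (k * a) *\<^sub>R e4"

lemma normal_vector_constant: assumes "v \<in> J" "w \<in> J" shows "normal_vector v = normal_vector w"
proof -
  have "((\<lambda>v. (b * k) *\<^sub>R l v + b *\<^sub>R n v) has_vector_derivative
      (b * k) *\<^sub>R t v + b *\<^sub>R (- \<kappa> v *\<^sub>R t v)) (at v within J)" if "v \<in> J" for v
    by (intro has_vector_derivative_add deriv_l deriv_n that
        bounded_linear.has_vector_derivative[OF bounded_linear_scaleR_right])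
  then have "((\<lambda>v. (b * k) *\<^sub>R l v + b *\<^sub>R n v) has_vector_derivative 0) (at v within J)" if "v \<in> J" for v
    using \<kappa>[OF that] that by fastforce
  then have "(b * k) *\<^sub>R l v + b *\<^sub>R n v = (b * k) *\<^sub>R l w + b *\<^sub>R n w"
    using zero_vderiv_constant[OF J _ assms] by blast
  then show ?thesis by (simp add: normal_vector_def)
qed

lemma mink_normal_vector: "v \<in> J \<Longrightarrow> mink (normal_vector v) (normal_vector v) = b\<^sup>2 - k\<^sup>2"
  unfolding normal_vector_def mink_frame using a_sq by algebra

lemma affine_surface_in_hyperplane:
  assumes "v0 \<in> J"
  shows "surface_in I J z (hyperplane (normal_vector v0) (b * k * a1 - k * a * b1))"
  unfolding surface_in_def hyperplane_def
proof (intro ballI CollectI)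
  fix u v assume uv: "u \<in> I" "v \<in> J"
  have z: "z u v = f u *\<^sub>R l v + 0 *\<^sub>R t v + 0 *\<^sub>R n v + g u *\<^sub>R e4" by (simp add: meridian_surface_def)
  have "mink (z u v) (normal_vector v0) = mink (z u v) (normal_vector v)"
    using normal_vector_constant[OF assms uv(2)] by simp
  also have "\<dots> = f u * (b * k) - g u * (k * a)"
    unfolding z normal_vector_def mink_frame[OF uv(2)] by simp
  also have "\<dots> = b * k * a1 - k * a * b1"
    by (simp add: f_g_affine uv algebra_simps)
  finally show "mink (z u v) (normal_vector v0) = b * k * a1 - k * a * b1" .
qed

lemma affine_E3:
  assumes "k\<^sup>2 - b\<^sup>2 > 0" shows "\<exists>W. hyperplane_E3 W \<and> surface_in I J z W"
proof -
  obtain u0 v0 where uv: "u0 \<in> I" "v0 \<in> J" using I_ne J_ne by blast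
  note in_W = affine_surface_in_hyperplane[OF uv(2)]
  have "mink (normal_vector v0) (normal_vector v0) < 0" using mink_normal_vector[OF uv(2)] assms by simp
  then show ?thesis using hyperplane_E3_timelike in_W uv unfolding surface_in_def by blast
qed

lemma affine_E31:
  assumes "k\<^sup>2 - b\<^sup>2 < 0" shows "\<exists>W. hyperplane_E31 W \<and> surface_in I J z W"
proof -
  obtain u0 v0 where uv: "u0 \<in> I" "v0 \<in> J" using I_ne J_ne by blast
  note in_W = affine_surface_in_hyperplane[OF uv(2)]
  let ?N = "normal_vector v0"
  let ?W = "hyperplane ?N (b * k * a1 - k * a * b1)"
  have w: "z u0 v0 \<in> ?W" using in_W uv by (simp add: surface_in_def)
  define s where "s = sqrt (b\<^sup>2 - k\<^sup>2)"
  have s: "s * s = b\<^sup>2 - k\<^sup>2" "s \<noteq> 0" using assms by (simp_all add: s_def)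
  \<comment> \<open>\<open>d1\<close>, \<open>d2\<close> are the tangent frame and \<open>d3\<close>
    is the mean curvature direction \<open>2 f H / s\<close>: it is orthogonal to \<open>?N\<close>,
    and \<open>2 f H\<close> has square \<open>k\<^sup>2 - b\<^sup>2 = - s\<^sup>2\<close>.\<close>
  define d1 where "d1 = a *\<^sub>R l v0 + 0 *\<^sub>R t v0 + 0 *\<^sub>R n v0 + b *\<^sub>R e4"
  define d2 where "d2 = 0 *\<^sub>R l v0 + 1 *\<^sub>R t v0 + 0 *\<^sub>R n v0 + 0 *\<^sub>R e4"
  define d3 where "d3 = (b * b / s) *\<^sub>R l v0 + 0 *\<^sub>R t v0 + (k / s) *\<^sub>R n v0 + (a * b / s) *\<^sub>R e4"
  note defs = d1_def d2_def d3_def normal_vector_def mink_frame[OF uv(2)]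
  have "mink d1 ?N = 0" "mink d2 ?N = 0" unfolding defs by simp_all
  moreover have "mink d3 ?N = 0"
  proof -
    have "b * b * (b * k) + k * b - a * b * (k * a) = 0" using a_sq by algebra
    then show ?thesis unfolding defs by (simp flip: add_divide_distrib diff_divide_distrib)
  qed
  moreover have "mink d1 d1 = 1" "mink d2 d2 = 1" "mink d1 d2 = 0" "mink d2 d3 = 0" "mink d1 d3 = 0"
    unfolding defs using a_sq by (simp_all add: power2_eq_square)
  moreover have "mink d3 d3 = - 1"
  proof -
    have "b * b * (b * b) + k * k - a * b * (a * b) = - (s * s)" using a_sq s(1) by algebra
    then show ?thesis unfolding defs using s(2)
      by (simp flip: add_divide_distrib diff_divide_distrib add: times_divide_times_eq)
  qed
  moreover have "mink ?N ?N \<noteq> 0" using mink_normal_vector[OF uv(2)] assms by simp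
  ultimately have "hyperplane_E31 ?W"
    unfolding hyperplane_E31_def directions_hyperplane[OF w] using hyperplane_affine by blast
  then show ?thesis using in_W by blast
qed

end

end

theorem theorem6p1:
  fixes I J :: "real set"
    and f g :: "real \<Rightarrow> real"
    and l n :: "real \<Rightarrow> real ^ 4"
    and z :: "real \<Rightarrow> real \<Rightarrow> real ^ 4"
    and \<kappa> :: "real \<Rightarrow> real"
    and case_i :: "real \<Rightarrow> real \<Rightarrow> real \<Rightarrow> bool"
    and case_ii :: "real \<Rightarrow> real \<Rightarrow> real \<Rightarrow> real \<Rightarrow> real \<Rightarrow> bool"
    and case_iii :: bool
  assumes "elliptic_meridian_data I J f g l n"
  defines "z \<equiv> meridian_surface f g l"
    and "\<kappa> \<equiv> spherical_curvature J l n"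
    and "case_i \<equiv> \<lambda>k a b.
           k \<noteq> 0 \<and> (\<forall>v\<in>J. \<kappa> v = k) \<and>
           ((\<forall>u\<in>I. f u = u + a) \<or> (\<forall>u\<in>I. f u = - u + a)) \<and> (\<forall>u\<in>I. g u = b)"
    and "case_ii \<equiv> \<lambda>k a a1 b b1.
           (\<forall>v\<in>J. \<kappa> v = k) \<and>
           (\<forall>u\<in>I. f u = a * u + a1) \<and> (\<forall>u\<in>I. g u = b * u + b1) \<and>
           a\<^sup>2 \<ge> 1 \<and> a\<^sup>2 - b\<^sup>2 = 1"
    and "case_iii \<equiv>
           (\<forall>v\<in>J. \<kappa> v = 0) \<and> meridian_ode I f \<and>
           (\<forall>u\<in>I. vderiv I g u = sqrt ((vderiv I f u)\<^sup>2 - 1) \<or>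
                  vderiv I g u = - sqrt ((vderiv I f u)\<^sup>2 - 1))"
  shows
    "(pointwise_1_type_second_kind I J f z \<longleftrightarrow>
        (\<exists>k a b. case_i k a b) \<or> (\<exists>k a a1 b b1. case_ii k a a1 b b1) \<or> case_iii) \<and>
     (\<forall>k a b. case_i k a b \<longrightarrow>
        developable_ruled I J z \<and> (\<exists>W. hyperplane_E3 W \<and> surface_in I J z W)) \<and>
     (\<forall>k a a1 b b1. case_ii k a a1 b b1 \<longrightarrow>
        developable_ruled I J z \<and>
        (k\<^sup>2 = b\<^sup>2 \<and> b \<noteq> 0 \<longrightarrow> marginally_trapped I J f z) \<and>
        (k\<^sup>2 - b\<^sup>2 > 0 \<longrightarrow> (\<exists>W. hyperplane_E3 W \<and> surface_in I J z W)) \<and>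
        (k\<^sup>2 - b\<^sup>2 < 0 \<longrightarrow> (\<exists>W. hyperplane_E31 W \<and> surface_in I J z W)))"
proof -
  interpret elliptic_meridian I J f g l n by unfold_locales (rule assms(1))
  have ii: "case_ii k a a1 b b1 \<longleftrightarrow>
      (\<forall>v\<in>J. spherical_curvature J l n v = k) \<and> affine_meridian a a1 b b1" for k a a1 b b1
    by (simp add: case_ii_def \<kappa>_def affine_meridian_def)
  \<comment> \<open>Case (i) is the part of case (ii) with slope 1 or -1 and constant
    \<open>g\<close>; there \<open>k \<noteq> 0\<close> yields \<open>k\<^sup>2 - 0 > 0\<close> and
    hence the Euclidean hyperplane.\<close>
  have i: "k \<noteq> 0 \<and> (\<exists>s. case_ii k s a 0 b)" if "case_i k a b" for k a b
  proof -
    have "case_ii k 1 a 0 b \<or> case_ii k (- 1) a 0 b"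
      using that by (auto simp: case_i_def case_ii_def)
    then show ?thesis using that by (auto simp: case_i_def)
  qed
  \<comment> \<open>The clause on the derivative of \<open>g\<close> is the unit-speed relation,
    solved up to sign at each point.\<close>
  have iii: "case_iii \<longleftrightarrow> (\<forall>v\<in>J. spherical_curvature J l n v = 0) \<and> meridian_ode I f"
    by (auto simp: case_iii_def \<kappa>_def f1_sq abs_if split: if_splits)
  have "pointwise_1_type_second_kind I J f z \<longleftrightarrow>
      (\<exists>k a b. case_i k a b) \<or> (\<exists>k a a1 b b1. case_ii k a a1 b b1) \<or> case_iii"
  proof
    assume "pointwise_1_type_second_kind I J f z"
    then show "(\<exists>k a b. case_i k a b) \<or> (\<exists>k a a1 b b1. case_ii k a a1 b b1) \<or> case_iii"
      using affine_or_ode_if_pointwise unfolding z_def ii iii by blast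
  next
    assume "(\<exists>k a b. case_i k a b) \<or> (\<exists>k a a1 b b1. case_ii k a a1 b b1) \<or> case_iii"
    then have "(\<exists>k a a1 b b1. case_ii k a a1 b b1) \<or> case_iii" using i by blast
    then show "pointwise_1_type_second_kind I J f z"
      unfolding z_def ii iii using pointwise_if_affine pointwise_if_ode by blast
  qed
  moreover have dev: "developable_ruled I J z" if "case_ii k a a1 b b1" for k a a1 b b1
    using affine_developable that unfolding z_def ii by blast
  moreover have E3: "\<exists>W. hyperplane_E3 W \<and> surface_in I J z W"
    if "case_ii k a a1 b b1" "k\<^sup>2 - b\<^sup>2 > 0" for k a a1 b b1
    using affine_E3 that unfolding z_def ii by blast
  moreover have "\<exists>W. hyperplane_E31 W \<and> surface_in I J z W"
    if "case_ii k a a1 b b1" "k\<^sup>2 - b\<^sup>2 < 0" for k a a1 b b1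
    using affine_E31 that unfolding z_def ii by blast
  moreover have "marginally_trapped I J f z"
    if "case_ii k a a1 b b1" "k\<^sup>2 = b\<^sup>2" "b \<noteq> 0" for k a a1 b b1
    using affine_marginally_trapped that unfolding z_def ii by blast
  moreover have "developable_ruled I J z \<and> (\<exists>W. hyperplane_E3 W \<and> surface_in I J z W)"
    if c: "case_i k a b" for k a b
  proof -
    obtain s where "k \<noteq> 0" "case_ii k s a 0 b" using i[OF c] by blast
    then show ?thesis using dev E3[of k s a 0 b] by simp
  qed
  ultimately show ?thesis by blast
qed

end
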